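(* Let $\langle M,\in^M\rangle$ be a model of set theory of any of the following kinds: (i) a model of ZFC; (ii) a model of KP containing no amorphous set; (iii) an $\omega$-nonstandard model of KP (even one with amorphous sets); (iv) an $\omega$-nonstandard model of finite set theory $\mathrm{ZF}^{\neg\infty}$. Then the inclusion structure $\langle M,\subseteq^M\rangle$ is an $\omega$-saturated model of set-theoretic mereology.
   Context: For a structure $\langle M,\in^M\rangle$, the inclusion relation is $a\subseteq^M b$ iff for all $c\in M$, $c\in^M a$ implies $c\in^M b$. Set-theoretic mereology is the theory, in the language $\{\sqsubseteq\}$, stating that $\sqsubseteq$ is an unbounded (no largest element) atomic relatively complemented distributive lattice. $\omega$-saturated means every 1-type over finitely many parameters finitely satisfiable in the structure is realized. KP is Kripke–Platek set theory (with infinity). $\mathrm{ZF}^{\neg\infty}$ is ZF with the axiom of infinity replaced by its negation. A model is $\omega$-nonstandard if its natural numbers (finite ordinals) are not well-ordered externally, i.e. not isomorphic to the standard natural numbers. A set $a\in M$ is amorphous (in $M$) if $M$ satisfies that $a$ is infinite and every subset of $a$ is finite or has finite complement in $a$. *)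

theory Defs
  imports Main
begin

section \<open>First-order formulas in one binary relation symbol\<close>

text \<open>Structures are nonempty types \<open>'m\<close> with a binary relation \<open>R\<close>. The same syntax serves for
  the language of set theory and for the language of the inclusion relation. Variables are named
  by natural numbers.\<close>

datatype fm =
    Rel nat nat
  | Eq nat nat
  | Neg fm
  | Conj fm fm
  | Ex nat fm

primrec sat :: "('m \<Rightarrow> 'm \<Rightarrow> bool) \<Rightarrow> (nat \<Rightarrow> 'm) \<Rightarrow> fm \<Rightarrow> bool" where
  "sat R v (Rel i j) \<longleftrightarrow> R (v i) (v j)"
| "sat R v (Eq i j) \<longleftrightarrow> v i = v j"
| "sat R v (Neg \<phi>) \<longleftrightarrow> \<not> sat R v \<phi>"
| "sat R v (Conj \<phi> \<psi>) \<longleftrightarrow> sat R v \<phi> \<and> sat R v \<psi>"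
| "sat R v (Ex i \<phi>) \<longleftrightarrow> (\<exists>x. sat R (v(i := x)) \<phi>)"

primrec fv :: "fm \<Rightarrow> nat set" where
  "fv (Rel i j) = {i, j}"
| "fv (Eq i j) = {i, j}"
| "fv (Neg \<phi>) = fv \<phi>"
| "fv (Conj \<phi> \<psi>) = fv \<phi> \<union> fv \<psi>"
| "fv (Ex i \<phi>) = fv \<phi> - {i}"

text \<open>Bounded universal quantification is obtained from the bounded existential one by negation.\<close>

inductive delta0 :: "fm \<Rightarrow> bool" where
  "delta0 (Rel i j)"
| "delta0 (Eq i j)"
| "delta0 \<phi> \<Longrightarrow> delta0 (Neg \<phi>)"
| "delta0 \<phi> \<Longrightarrow> delta0 \<psi> \<Longrightarrow> delta0 (Conj \<phi> \<psi>)"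
| "delta0 \<phi> \<Longrightarrow> i \<noteq> j \<Longrightarrow> delta0 (Ex i (Conj (Rel i j) \<phi>))"

text \<open>In a 1-type over finitely many parameters, variable 0 is the type variable, and each variable
  in the finite set \<open>V - {0}\<close> stands for the parameter assigned to it by \<open>v\<close>.\<close>

definition omega_saturated :: "('m \<Rightarrow> 'm \<Rightarrow> bool) \<Rightarrow> bool" where
  "omega_saturated R \<longleftrightarrow>
    (\<forall>V (v :: nat \<Rightarrow> 'm) p.
       finite V \<longrightarrow> (\<forall>\<phi>\<in>p. fv \<phi> \<subseteq> insert 0 V) \<longrightarrow>
       (\<forall>q. q \<subseteq> p \<longrightarrow> finite q \<longrightarrow> (\<exists>x. \<forall>\<phi>\<in>q. sat R (v(0 := x)) \<phi>)) \<longrightarrow>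
       (\<exists>x. \<forall>\<phi>\<in>p. sat R (v(0 := x)) \<phi>))"


section \<open>Set-theoretic mereology\<close>

definition is_least :: "('m \<Rightarrow> 'm \<Rightarrow> bool) \<Rightarrow> 'm \<Rightarrow> bool" where
  "is_least le z \<longleftrightarrow> (\<forall>x. le z x)"

definition is_atom :: "('m \<Rightarrow> 'm \<Rightarrow> bool) \<Rightarrow> 'm \<Rightarrow> bool" where
  "is_atom le a \<longleftrightarrow> \<not> is_least le a \<and> (\<forall>b. le b a \<longrightarrow> is_least le b \<or> b = a)"

definition set_theoretic_mereology :: "('m \<Rightarrow> 'm \<Rightarrow> bool) \<Rightarrow> bool" where
  "set_theoretic_mereology le \<longleftrightarrow>
    (\<exists>meet join.
       class.distrib_lattice meet le (\<lambda>x y. le x y \<and> x \<noteq> y) join \<and>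
       (\<forall>a x b. le a x \<and> le x b \<longrightarrow> (\<exists>y. meet x y = a \<and> join x y = b))) \<and>
    (\<exists>z. is_least le z) \<and>
    (\<forall>x. \<not> is_least le x \<longrightarrow> (\<exists>a. is_atom le a \<and> le a x)) \<and>
    \<not> (\<exists>t. \<forall>x. le x t)"


section \<open>Models of set theory\<close>

context
  fixes mem :: "'m \<Rightarrow> 'm \<Rightarrow> bool"  (infix "\<epsilon>" 50)
begin

definition incl :: "'m \<Rightarrow> 'm \<Rightarrow> bool" where
  "incl a b \<longleftrightarrow> (\<forall>c. c \<epsilon> a \<longrightarrow> c \<epsilon> b)"

definition is_empty :: "'m \<Rightarrow> bool" where
  "is_empty a \<longleftrightarrow> (\<forall>x. \<not> x \<epsilon> a)"

definition is_succ :: "'m \<Rightarrow> 'm \<Rightarrow> bool" where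
  "is_succ s a \<longleftrightarrow> (\<forall>x. x \<epsilon> s \<longleftrightarrow> x \<epsilon> a \<or> x = a)"

definition is_upair :: "'m \<Rightarrow> 'm \<Rightarrow> 'm \<Rightarrow> bool" where
  "is_upair p a b \<longleftrightarrow> (\<forall>x. x \<epsilon> p \<longleftrightarrow> x = a \<or> x = b)"

text \<open>Kuratowski pairs.\<close>

definition is_opair :: "'m \<Rightarrow> 'm \<Rightarrow> 'm \<Rightarrow> bool" where
  "is_opair p a b \<longleftrightarrow> (\<exists>s d. is_upair s a a \<and> is_upair d a b \<and> is_upair p s d)"

definition is_bijection :: "'m \<Rightarrow> 'm \<Rightarrow> 'm \<Rightarrow> bool" where
  "is_bijection f a b \<longleftrightarrow>
     (\<forall>p. p \<epsilon> f \<longrightarrow> (\<exists>x y. x \<epsilon> a \<and> y \<epsilon> b \<and> is_opair p x y)) \<and>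
     (\<forall>x. x \<epsilon> a \<longrightarrow> (\<exists>!y. \<exists>p. p \<epsilon> f \<and> is_opair p x y)) \<and>
     (\<forall>y. y \<epsilon> b \<longrightarrow> (\<exists>!x. \<exists>p. p \<epsilon> f \<and> is_opair p x y))"

definition is_transitive :: "'m \<Rightarrow> bool" where
  "is_transitive a \<longleftrightarrow> (\<forall>x. x \<epsilon> a \<longrightarrow> incl x a)"

text \<open>Given foundation, ordinals are the transitive sets of transitive sets; an ordinal is finite
  iff it and all its elements are zero or successors.\<close>

definition is_ordinal :: "'m \<Rightarrow> bool" where
  "is_ordinal a \<longleftrightarrow> is_transitive a \<and> (\<forall>x. x \<epsilon> a \<longrightarrow> is_transitive x)"

definition is_natural :: "'m \<Rightarrow> bool" where
  "is_natural n \<longleftrightarrow> is_ordinal n \<and>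
     (\<forall>k. k \<epsilon> n \<or> k = n \<longrightarrow> is_empty k \<or> (\<exists>m. is_succ k m))"

definition is_finite :: "'m \<Rightarrow> bool" where
  "is_finite a \<longleftrightarrow> (\<exists>n f. is_natural n \<and> is_bijection f n a)"

definition is_diff :: "'m \<Rightarrow> 'm \<Rightarrow> 'm \<Rightarrow> bool" where
  "is_diff c a b \<longleftrightarrow> (\<forall>x. x \<epsilon> c \<longleftrightarrow> x \<epsilon> a \<and> \<not> x \<epsilon> b)"

definition amorphous :: "'m \<Rightarrow> bool" where
  "amorphous a \<longleftrightarrow> \<not> is_finite a \<and>
     (\<forall>b. incl b a \<longrightarrow> is_finite b \<or> (\<exists>c. is_diff c a b \<and> is_finite c))"

text \<open>Here well-orderedness is that of the metatheory.\<close>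

definition omega_nonstandard :: bool where
  "omega_nonstandard \<longleftrightarrow>
     \<not> well_order_on {n. is_natural n}
         {(m, n). is_natural m \<and> is_natural n \<and> (m \<epsilon> n \<or> m = n)}"

definition extensionality :: bool where
  "extensionality \<longleftrightarrow> (\<forall>a b. (\<forall>x. x \<epsilon> a \<longleftrightarrow> x \<epsilon> b) \<longrightarrow> a = b)"

definition pairing :: bool where
  "pairing \<longleftrightarrow> (\<forall>a b. \<exists>p. is_upair p a b)"

definition unions :: bool where
  "unions \<longleftrightarrow> (\<forall>a. \<exists>u. \<forall>x. x \<epsilon> u \<longleftrightarrow> (\<exists>y. y \<epsilon> a \<and> x \<epsilon> y))"

definition power_sets :: bool where
  "power_sets \<longleftrightarrow> (\<forall>a. \<exists>p. \<forall>x. x \<epsilon> p \<longleftrightarrow> incl x a)"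

definition infinity :: bool where
  "infinity \<longleftrightarrow> (\<exists>w. (\<exists>z. is_empty z \<and> z \<epsilon> w) \<and>
     (\<forall>x. x \<epsilon> w \<longrightarrow> (\<exists>s. is_succ s x \<and> s \<epsilon> w)))"

definition regularity :: bool where
  "regularity \<longleftrightarrow> (\<forall>a. \<not> is_empty a \<longrightarrow> (\<exists>x. x \<epsilon> a \<and> \<not> (\<exists>y. y \<epsilon> x \<and> y \<epsilon> a)))"

text \<open>Every family of pairwise disjoint nonempty sets has a transversal.\<close>

definition choice :: bool where
  "choice \<longleftrightarrow> (\<forall>a. (\<forall>x. x \<epsilon> a \<longrightarrow> \<not> is_empty x) \<longrightarrow>
     (\<forall>x y. x \<epsilon> a \<and> y \<epsilon> a \<and> x \<noteq> y \<longrightarrow> \<not> (\<exists>z. z \<epsilon> x \<and> z \<epsilon> y)) \<longrightarrow>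
     (\<exists>c. \<forall>x. x \<epsilon> a \<longrightarrow> (\<exists>!z. z \<epsilon> c \<and> z \<epsilon> x)))"

text \<open>In the schemes the free variables other than 0 (and 1) are parameters, assigned by \<open>v\<close>. The
  set asserted to exist is not in the range of any variable, so no freshness condition is needed.\<close>

definition separation_for :: "fm \<Rightarrow> bool" where
  "separation_for \<phi> \<longleftrightarrow>
     (\<forall>v a. \<exists>b. \<forall>x. x \<epsilon> b \<longleftrightarrow> x \<epsilon> a \<and> sat mem (v(0 := x)) \<phi>)"

definition replacement_for :: "fm \<Rightarrow> bool" where
  "replacement_for \<phi> \<longleftrightarrow>
     (\<forall>v a. (\<forall>x. x \<epsilon> a \<longrightarrow> (\<exists>!y. sat mem (v(0 := x, 1 := y)) \<phi>)) \<longrightarrow>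
       (\<exists>b. \<forall>y. y \<epsilon> b \<longleftrightarrow> (\<exists>x. x \<epsilon> a \<and> sat mem (v(0 := x, 1 := y)) \<phi>)))"

definition collection_for :: "fm \<Rightarrow> bool" where
  "collection_for \<phi> \<longleftrightarrow>
     (\<forall>v a. (\<forall>x. x \<epsilon> a \<longrightarrow> (\<exists>y. sat mem (v(0 := x, 1 := y)) \<phi>)) \<longrightarrow>
       (\<exists>b. \<forall>x. x \<epsilon> a \<longrightarrow> (\<exists>y. y \<epsilon> b \<and> sat mem (v(0 := x, 1 := y)) \<phi>)))"

definition foundation_for :: "fm \<Rightarrow> bool" where
  "foundation_for \<phi> \<longleftrightarrow>
     (\<forall>v. (\<exists>x. sat mem (v(0 := x)) \<phi>) \<longrightarrow>
       (\<exists>x. sat mem (v(0 := x)) \<phi> \<and> (\<forall>y. y \<epsilon> x \<longrightarrow> \<not> sat mem (v(0 := y)) \<phi>)))"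

text \<open>The axioms of ZF other than infinity; the empty set exists by separation.\<close>

definition ZF_without_infinity :: bool where
  "ZF_without_infinity \<longleftrightarrow>
     extensionality \<and> regularity \<and> pairing \<and> unions \<and> power_sets \<and>
     (\<forall>\<phi>. separation_for \<phi>) \<and> (\<forall>\<phi>. replacement_for \<phi>)"

definition model_ZFC :: bool where
  "model_ZFC \<longleftrightarrow> ZF_without_infinity \<and> infinity \<and> choice"

definition model_ZF_neg_infinity :: bool where
  "model_ZF_neg_infinity \<longleftrightarrow> ZF_without_infinity \<and> \<not> infinity"

text \<open>Kripke--Platek set theory with infinity and the foundation scheme for all formulas.\<close>

definition model_KP :: bool where
  "model_KP \<longleftrightarrow>
     extensionality \<and> pairing \<and> unions \<and> infinity \<and>
     (\<forall>\<phi>. foundation_for \<phi>) \<and>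
     (\<forall>\<phi>. delta0 \<phi> \<longrightarrow> separation_for \<phi>) \<and>
     (\<forall>\<phi>. delta0 \<phi> \<longrightarrow> collection_for \<phi>)"

end

end

theory Submission
  imports Defs "HOL-Library.Countable"
begin

text \<open>Identifying a set of the model with its extension turns inclusion in the model into inclusion
  in a ring of subsets of \<open>'m\<close> containing all finite sets, and this gives the mereology. A back-and-forth
  argument shows that the truth of a formula of quantifier depth \<open>d\<close> depends only on the
  cardinalities, truncated at \<open>2 ^ d\<close>, of the cells cut out by the parameters. A type is therefore
  realized as soon as the limiting cell sizes of its finite approximations are realized, and for
  this it suffices that every infinite set of the ring splits into two infinite ones and that
  outside every set there is an infinite one.

  Splitting is where the four kinds of models differ: an \<open>\<omega>\<close>-nonstandard model splits an
  externally infinite set by overspill, in an \<open>\<omega>\<close>-standard one it is the absence of amorphous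
  sets, and the axiom of choice lets one pick points of the set one at a time, collecting every
  second one.\<close>

section \<open>Truncated cardinalities\<close>

text \<open>Finiteness is always that of the metatheory: a set that the model takes to be finite may
  be infinite, and it must then be split as well. Finite subsets of a member of the ring are
  members, and so are their complements in it. The back-and-forth step therefore takes its witness
  finite or cofinite in each cell and never has to split a set into two infinite pieces. The base 2
  of the truncation comes from this step: a new parameter cuts a cell in two, and to copy both parts
  up to \<open>n\<close> into another cell, the two cells must agree up to \<open>2 * n\<close>.
  Pieces that are infinite with infinite complement are forced only in the limit: along a sequence
  of approximate realizations, the sizes on both sides of the cut may grow without bound. The
  obstacle throughout is the outer cell, the points of no parameter. It is not a member of the ring,
  and \<open>infinite_outside\<close> supplies what is needed there.\<close>

definition tcard :: "nat \<Rightarrow> 'a set \<Rightarrow> nat" where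
  "tcard n X = (if finite X then min n (card X) else n)"

lemma tcard_mono: "tcard m X = tcard m Y \<Longrightarrow> n \<le> m \<Longrightarrow> tcard n X = tcard n Y"
  unfolding tcard_def by (auto split: if_splits)

lemma tcard_Un_disjoint:
  "A \<inter> B = {} \<Longrightarrow> tcard n (A \<union> B) = min n (tcard n A + tcard n B)"
  unfolding tcard_def by (auto simp: card_Un_disjoint)

lemma tcard_eq_0_iff: "0 < n \<Longrightarrow> tcard n X = 0 \<longleftrightarrow> X = {}"
  unfolding tcard_def by (auto simp: min_def)

lemma tcard_subset_exists:
  assumes "m \<le> tcard k Y"
  obtains B where "B \<subseteq> Y" "finite B" "card B = m"
proof (cases "finite Y")
  case True
  then have "m \<le> card Y" using assms unfolding tcard_def by auto
  then show ?thesis using that obtain_subset_with_card_n by metis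
next
  case False
  then show ?thesis using that infinite_arbitrarily_large by metis
qed

lemma tcard_Diff_cong:
  assumes "tcard (2 * n) X = tcard (2 * n) Y" "A \<subseteq> X" "B \<subseteq> Y"
    and "finite A" "finite B" "card A = card B" "card A \<le> n"
  shows "tcard n (X - A) = tcard n (Y - B)"
  using assms card_mono[of X A] card_mono[of Y B] unfolding tcard_def
  by (auto simp: card_Diff_subset finite_subset split: if_splits)

text \<open>A part with fewer than \<open>n\<close> points is copied exactly, on either side of the
  cut; if both parts have at least \<open>n\<close>, then \<open>Y\<close> has at least
  \<open>2 * n\<close> points and any \<open>n\<close> of them will do. The last clause records that
  \<open>B\<close> is finite or cofinite, hence available without any splitting axiom.\<close>

lemma tcard_split:
  assumes eq: "tcard (2 * n) X = tcard (2 * n) Y" and "A \<subseteq> X"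
  shows "\<exists>B\<subseteq>Y. tcard n B = tcard n A \<and> tcard n (Y - B) = tcard n (X - A) \<and>
    (finite B \<or> finite (Y - B) \<and> finite (X - A))"
proof -
  consider (small) "finite A" "card A < n" | (cosmall) "finite (X - A)" "card (X - A) < n"
    | (large) "tcard n A = n" "tcard n (X - A) = n"
    unfolding tcard_def by (cases "finite A"; cases "finite (X - A)"; linarith?; simp; linarith)
  then show ?thesis
  proof cases
    case small
    have "card A \<le> tcard (2 * n) X"
      using small \<open>A \<subseteq> X\<close> unfolding tcard_def by (auto intro: card_mono)
    then obtain B where B: "B \<subseteq> Y" "finite B" "card B = card A"
      using eq by (metis tcard_subset_exists)
    then show ?thesis
      using tcard_Diff_cong[OF eq \<open>A \<subseteq> X\<close> B(1)] small
      by (intro exI[of _ B]) (auto simp: tcard_def)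
  next
    case cosmall
    have "card (X - A) \<le> tcard (2 * n) X"
      using cosmall unfolding tcard_def by (auto intro: card_mono)
    then obtain B where B: "B \<subseteq> Y" "finite B" "card B = card (X - A)"
      using eq by (metis tcard_subset_exists)
    have "X - (X - A) = A" "Y - (Y - B) = B" using \<open>A \<subseteq> X\<close> B(1) by auto
    then show ?thesis
      using tcard_Diff_cong[OF eq _ B(1), of "X - A"] cosmall B
      by (intro exI[of _ "Y - B"]) (auto simp: tcard_def)
  next
    case large
    have "finite X \<Longrightarrow> card X = card A + card (X - A)"
      using \<open>A \<subseteq> X\<close> card_mono[of X A] by (auto simp: card_Diff_subset finite_subset)
    then have "tcard (2 * n) X = 2 * n"
      using large \<open>A \<subseteq> X\<close> unfolding tcard_def by (auto dest: finite_subset split: if_splits)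
    then have Y: "tcard (2 * n) Y = 2 * n" using eq by simp
    then obtain B where B: "B \<subseteq> Y" "finite B" "card B = n"
      using tcard_subset_exists[of n "2 * n" Y] by auto
    then have "tcard n (Y - B) = n"
      using Y unfolding tcard_def by (auto simp: card_Diff_subset split: if_splits)
    then show ?thesis
      using B large by (intro exI[of _ B]) (auto simp: tcard_def)
  qed
qed


section \<open>Rings of sets\<close>

locale ring_of_sets_order =
  fixes le :: "'m \<Rightarrow> 'm \<Rightarrow> bool" and ext :: "'m \<Rightarrow> 'z set"
  assumes le_iff: "le a b \<longleftrightarrow> ext a \<subseteq> ext b"
    and ext_inject: "ext a = ext b \<Longrightarrow> a = b"
    and range_finite: "finite F \<Longrightarrow> F \<in> range ext"
    and range_Un: "A \<in> range ext \<Longrightarrow> B \<in> range ext \<Longrightarrow> A \<union> B \<in> range ext"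
    and range_Diff: "A \<in> range ext \<Longrightarrow> B \<in> range ext \<Longrightarrow> A - B \<in> range ext"
    and infinite_split: "A \<in> range ext \<Longrightarrow> infinite A \<Longrightarrow>
      \<exists>B \<in> range ext. B \<subseteq> A \<and> infinite B \<and> infinite (A - B)"
    and infinite_outside: "A \<in> range ext \<Longrightarrow> \<exists>B \<in> range ext. infinite B \<and> A \<inter> B = {}"
begin

lemma range_Int: "A \<in> range ext \<Longrightarrow> B \<in> range ext \<Longrightarrow> A \<inter> B \<in> range ext"
  using range_Diff[of A "A - B"] range_Diff[of A B] by (simp add: Diff_Diff_Int)

lemma range_UN: "finite I \<Longrightarrow> (\<And>i. i \<in> I \<Longrightarrow> B i \<in> range ext) \<Longrightarrow> (\<Union>i\<in>I. B i) \<in> range ext"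
proof (induction I rule: finite_induct)
  case empty
  then show ?case using range_finite[of "{}"] by simp
next
  case (insert i I)
  then show ?case using range_Un[of "B i" "\<Union>i\<in>I. B i"] by auto
qed

lemma is_least_iff: "is_least le z \<longleftrightarrow> ext z = {}"
  using range_finite[of "{}"] unfolding is_least_def le_iff by auto

lemma set_theoretic_mereology: "set_theoretic_mereology le"
proof -
  have ex: "\<exists>c. ext c = A" if "A \<in> range ext" for A using that by auto
  define meet where "meet a b = (SOME c. ext c = ext a \<inter> ext b)" for a b
  define join where "join a b = (SOME c. ext c = ext a \<union> ext b)" for a b
  have meet: "ext (meet a b) = ext a \<inter> ext b" for a b
    unfolding meet_def by (rule someI_ex) (auto intro!: ex range_Int)
  have join: "ext (join a b) = ext a \<union> ext b" for a b
    unfolding join_def by (rule someI_ex) (auto intro!: ex range_Un)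
  have lattice: "class.distrib_lattice meet le (\<lambda>x y. le x y \<and> x \<noteq> y) join"
    by unfold_locales (auto simp: le_iff meet join intro!: ext_inject)
  have complement: "\<exists>y. meet x y = a \<and> join x y = b" if "le a x" "le x b" for a x b
  proof -
    have "ext a \<union> (ext b - ext x) \<in> range ext" by (intro range_Un range_Diff) auto
    then obtain y where "ext y = ext a \<union> (ext b - ext x)" by auto
    then show ?thesis
      using that
      by (intro exI[of _ y] conjI ext_inject) (auto simp: le_iff meet join dest: subsetD)
  qed
  have least: "\<exists>z. is_least le z" using range_finite[of "{}"] unfolding is_least_iff by auto
  have atom: "\<exists>a. is_atom le a \<and> le a x" if "\<not> is_least le x" for x
  proof -
    have "ext x \<noteq> {}" using that by (simp add: is_least_iff)
    then obtain t where "t \<in> ext x" by auto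
    obtain a where a: "ext a = {t}" using range_finite[of "{t}"] by auto
    show ?thesis
      using a \<open>t \<in> ext x\<close> by (intro exI[of _ a])
        (auto simp: is_atom_def is_least_iff le_iff intro!: ext_inject)
  qed
  have unbounded: "\<not> (\<exists>t. \<forall>x. le x t)"
    using infinite_outside by (auto simp: le_iff) (metis inf.absorb2 infinite_imp_nonempty rangeI)
  show ?thesis
    unfolding set_theoretic_mereology_def
    using lattice complement least atom unbounded by blast
qed

section \<open>The Venn regions of finitely many parameters\<close>

definition cell :: "nat set \<Rightarrow> (nat \<Rightarrow> 'm) \<Rightarrow> nat set \<Rightarrow> 'z set" where
  "cell V v S = {z. {i \<in> V. z \<in> ext (v i)} = S}"

definition cells_equiv :: "nat \<Rightarrow> nat set \<Rightarrow> (nat \<Rightarrow> 'm) \<Rightarrow> (nat \<Rightarrow> 'm) \<Rightarrow> bool" where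
  "cells_equiv n V v w \<longleftrightarrow> (\<forall>S. tcard n (cell V v S) = tcard n (cell V w S))"

lemma cell_insert:
  assumes "i \<notin> V"
  shows "cell (insert i V) (v(i := x)) T =
    (if i \<in> T then cell V v (T - {i}) \<inter> ext x else cell V v T - ext x)"
  using assms unfolding cell_def by (auto; fastforce?)

lemma cell_not_subset: "\<not> S \<subseteq> V \<Longrightarrow> cell V v S = {}"
  unfolding cell_def by auto

text \<open>A nonempty index puts the cell inside a parameter; the cell of \<open>{}\<close> lies
  outside all of them, and its complement is their union. One induction carries both claims because
  the cell of index \<open>{i}\<close> is cut from the old outer cell.\<close>

lemma cell_range:
  assumes "finite V"
  shows "(S \<noteq> {} \<longrightarrow> cell V v S \<in> range ext) \<and> - cell V v {} \<in> range ext"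
  using assms
proof (induction V arbitrary: S rule: finite_induct)
  case empty
  have "cell {} v {} = UNIV" "S \<noteq> {} \<Longrightarrow> cell {} v S = {}" unfolding cell_def by auto
  then show ?case using range_finite[of "{}"] by auto
next
  case (insert i V)
  have cell: "cell (insert i V) v T =
    (if i \<in> T then cell V v (T - {i}) \<inter> ext (v i) else cell V v T - ext (v i))" for T
    using cell_insert[OF insert.hyps(2), of v "v i" T] by simp
  have "cell V v {} \<inter> ext (v i) = ext (v i) - (- cell V v {})" by auto
  then have "cell V v {} \<inter> ext (v i) \<in> range ext"
    using range_Diff[of "ext (v i)" "- cell V v {}"] insert.IH[of "{}"] by auto
  then have "cell V v T \<inter> ext (v i) \<in> range ext" for T
    using insert.IH[of T] range_Int[of "cell V v T" "ext (v i)"] by (cases "T = {}") auto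
  then have "S \<noteq> {} \<longrightarrow> cell (insert i V) v S \<in> range ext"
    unfolding cell using insert.IH[of S] range_Diff[of "cell V v S" "ext (v i)"] by simp
  moreover have "- cell (insert i V) v {} = (- cell V v {}) \<union> ext (v i)"
    unfolding cell by auto
  ultimately show ?case using insert.IH[of "{}"] range_Un by auto
qed

text \<open>Distinct cells are disjoint, so the union of the pieces meets each cell only in its own
  piece.\<close>

lemma cells_glue:
  assumes "finite V" and B: "\<And>S. S \<subseteq> V \<Longrightarrow> B S \<subseteq> cell V w S \<and> B S \<in> range ext"
  shows "\<exists>y. \<forall>S\<subseteq>V. cell V w S \<inter> ext y = B S \<and> cell V w S - ext y = cell V w S - B S"
proof -
  have "(\<Union>S\<in>Pow V. B S) \<in> range ext" using assms by (intro range_UN) auto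
  then obtain y where y: "ext y = (\<Union>S\<in>Pow V. B S)" by auto
  have disj: "cell V w S \<inter> cell V w T = {}" if "S \<noteq> T" for S T
    using that unfolding cell_def by auto
  have "cell V w S \<inter> ext y = B S" if "S \<subseteq> V" for S
  proof
    show "B S \<subseteq> cell V w S \<inter> ext y" using B[OF that] that unfolding y by auto
    show "cell V w S \<inter> ext y \<subseteq> B S"
    proof
      fix z assume z: "z \<in> cell V w S \<inter> ext y"
      then obtain T where T: "T \<subseteq> V" "z \<in> B T" unfolding y by auto
      then have "z \<in> cell V w T" using B[OF T(1)] by auto
      then have "T = S" using z disj[of S T] by auto
      then show "z \<in> B S" using T by simp
    qed
  qed
  then show ?thesis by (intro exI[of _ y]) auto
qed

lemma cells_equiv_insertI:
  assumes "i \<notin> V"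
    and "\<And>S. S \<subseteq> V \<Longrightarrow> tcard n (cell V v S \<inter> ext x) = tcard n (cell V w S \<inter> ext y) \<and>
      tcard n (cell V v S - ext x) = tcard n (cell V w S - ext y)"
  shows "cells_equiv n (insert i V) (v(i := x)) (w(i := y))"
  unfolding cells_equiv_def
proof
  fix T
  show "tcard n (cell (insert i V) (v(i := x)) T) = tcard n (cell (insert i V) (w(i := y)) T)"
  proof (cases "T \<subseteq> insert i V")
    case True
    then have "T - {i} \<subseteq> V" "i \<notin> T \<Longrightarrow> T \<subseteq> V" by auto
    then show ?thesis using assms by (auto simp: cell_insert)
  qed (simp add: cell_not_subset)
qed

text \<open>The forth step: \<open>tcard_split\<close> acts in each cell separately and the pieces
  are glued.\<close>

lemma cells_equiv_extend:
  assumes "finite V" "i \<notin> V" and equiv: "cells_equiv (2 * n) V v w"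
  shows "\<exists>y. cells_equiv n (insert i V) (v(i := x)) (w(i := y))"
proof -
  have "\<exists>B. B \<subseteq> cell V w S \<and> tcard n B = tcard n (cell V v S \<inter> ext x) \<and>
      tcard n (cell V w S - B) = tcard n (cell V v S - cell V v S \<inter> ext x) \<and>
      (finite B \<or> finite (cell V w S - B) \<and> finite (cell V v S - cell V v S \<inter> ext x))" for S
    using tcard_split[of n "cell V v S" "cell V w S" "cell V v S \<inter> ext x"] equiv
    unfolding cells_equiv_def by auto
  then obtain B where B: "\<And>S. B S \<subseteq> cell V w S"
    "\<And>S. tcard n (B S) = tcard n (cell V v S \<inter> ext x)"
    "\<And>S. tcard n (cell V w S - B S) = tcard n (cell V v S - cell V v S \<inter> ext x)"
    "\<And>S. finite (B S) \<or>
       finite (cell V w S - B S) \<and> finite (cell V v S - cell V v S \<inter> ext x)"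
    by metis
  have "B S \<in> range ext" for S
  proof (cases "finite (B S)")
    case False
    then have fin: "finite (cell V w S - B S)" "finite (cell V v S - ext x)"
      using B(4)[of S] by (auto simp: Diff_Int)
    \<comment> \<open>No cofinite piece is requested in the outer cell: the parameters together with
      \<open>ext x\<close> leave infinitely many points uncovered.\<close>
    have "S \<noteq> {}"
    proof
      assume "S = {}"
      have "- cell V v {} \<union> ext x \<in> range ext"
        using cell_range[OF \<open>finite V\<close>, of "{}" v] by (intro range_Un) auto
      then obtain D where "infinite D" "(- cell V v {} \<union> ext x) \<inter> D = {}"
        using infinite_outside by blast
      then have "D \<subseteq> cell V v S - ext x" using \<open>S = {}\<close> by auto
      then show False using fin(2) \<open>infinite D\<close> finite_subset by blast
    qed
    then have "cell V w S \<in> range ext" using cell_range[OF \<open>finite V\<close>] by blast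
    then have "cell V w S - (cell V w S - B S) \<in> range ext"
      using range_finite[OF fin(1)] by (rule range_Diff)
    then show ?thesis using B(1)[of S] by (simp add: double_diff)
  qed (simp add: range_finite)
  then obtain y where "\<forall>S\<subseteq>V. cell V w S \<inter> ext y = B S \<and> cell V w S - ext y = cell V w S - B S"
    using cells_glue[OF \<open>finite V\<close>, of B w] B(1) by blast
  then show ?thesis
    using B(2,3) \<open>i \<notin> V\<close>
    by (intro exI[of _ y] cells_equiv_insertI) (auto simp: Diff_Int)
qed

text \<open>Forgetting a parameter merges disjoint cells in pairs, and truncated sizes add. This
  discards the old value of a variable before a quantifier rebinds it.\<close>

lemma cells_equiv_remove:
  assumes "cells_equiv n V v w"
  shows "cells_equiv n (V - {i}) v w"
proof (cases "i \<in> V")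
  case True
  have cell: "cell (V - {i}) u S = (if i \<in> S then {} else cell V u S \<union> cell V u (insert i S))"
    for u S
    using True unfolding cell_def by (auto; fastforce?)
  have disj: "cell V u S \<inter> cell V u (insert i S) = {}" if "i \<notin> S" for u S
    using that unfolding cell_def by auto
  show ?thesis
    using assms unfolding cells_equiv_def cell by (auto simp: tcard_Un_disjoint disj)
qed (use assms in simp)

text \<open>Atomic formulas only ask which cells are empty, hence level 1; each quantifier doubles
  the level to pay for one use of \<open>cells_equiv_extend\<close>.\<close>

primrec threshold :: "fm \<Rightarrow> nat" where
  "threshold (Rel i j) = 1"
| "threshold (Eq i j) = 1"
| "threshold (Neg \<phi>) = threshold \<phi>"
| "threshold (Conj \<phi> \<psi>) = max (threshold \<phi>) (threshold \<psi>)"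
| "threshold (Ex i \<phi>) = 2 * threshold \<phi>"

lemma cells_equiv_mono: "cells_equiv m V v w \<Longrightarrow> n \<le> m \<Longrightarrow> cells_equiv n V v w"
  unfolding cells_equiv_def using tcard_mono by blast

lemma cells_equiv_sym: "cells_equiv n V v w \<Longrightarrow> cells_equiv n V w v"
  unfolding cells_equiv_def by auto

text \<open>An inclusion fails exactly when some cell inside the first set and outside the second is
  nonempty, and level 1 detects this.\<close>

lemma cells_equiv_subset:
  assumes "cells_equiv 1 V v w" "i \<in> V" "j \<in> V"
  shows "ext (v i) \<subseteq> ext (v j) \<longleftrightarrow> ext (w i) \<subseteq> ext (w j)"
proof -
  have "ext (u i) \<subseteq> ext (u j) \<longleftrightarrow> (\<forall>S. i \<in> S \<and> j \<notin> S \<longrightarrow> cell V u S = {})" for u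
    using assms(2,3) unfolding cell_def by auto
  moreover have "cell V v S = {} \<longleftrightarrow> cell V w S = {}" for S
    using assms(1) unfolding cells_equiv_def by (metis tcard_eq_0_iff zero_less_one)
  ultimately show ?thesis by simp
qed

lemma sat_cells_equiv:
  "finite V \<Longrightarrow> fv \<phi> \<subseteq> V \<Longrightarrow> cells_equiv (threshold \<phi>) V v w \<Longrightarrow> sat le v \<phi> \<longleftrightarrow> sat le w \<phi>"
proof (induction \<phi> arbitrary: V v w)
  case (Rel i j)
  then show ?case using cells_equiv_subset[of V v w i j] by (simp add: le_iff)
next
  case (Eq i j)
  have "u i = u j \<longleftrightarrow> ext (u i) \<subseteq> ext (u j) \<and> ext (u j) \<subseteq> ext (u i)" for u
    using ext_inject by auto
  then show ?case
    using Eq cells_equiv_subset[of V v w i j] cells_equiv_subset[of V v w j i] by simp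
next
  case (Neg \<phi>)
  then show ?case by simp
next
  case (Conj \<phi> \<psi>)
  then show ?case
    using Conj.IH(1)[of V v w] Conj.IH(2)[of V v w]
      cells_equiv_mono[of "threshold (Conj \<phi> \<psi>)" V v w "threshold \<phi>"]
      cells_equiv_mono[of "threshold (Conj \<phi> \<psi>)" V v w "threshold \<psi>"]
    by simp
next
  case (Ex i \<phi>)
  let ?V = "V - {i}"
  have equiv: "cells_equiv (2 * threshold \<phi>) ?V v w" "cells_equiv (2 * threshold \<phi>) ?V w v"
    using Ex.prems(3) cells_equiv_remove cells_equiv_sym by auto
  have V: "finite ?V" "i \<notin> ?V" "finite (insert i ?V)" "fv \<phi> \<subseteq> insert i ?V"
    using Ex.prems by auto
  \<comment> \<open>Arbitrary \<open>v'\<close> and \<open>w'\<close> let this serve both as forth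
    and as back.\<close>
  have "\<exists>y. sat le (w'(i := y)) \<phi>"
    if "cells_equiv (2 * threshold \<phi>) ?V v' w'" "sat le (v'(i := x)) \<phi>" for v' w' x
    using cells_equiv_extend[OF V(1,2) that(1), of x] Ex.IH[OF V(3,4)] that(2) by blast
  then show ?case using equiv by auto
qed

text \<open>A sequence of subsets of a cell either takes one finite or one cofinite size infinitely
  often, or both its members and their complements grow beyond every finite bound.\<close>

lemma limit_in_cell:
  fixes A :: "nat \<Rightarrow> 'z set"
  assumes C: "C \<in> range ext \<or> - C \<in> range ext"
    and A: "\<And>k. A k \<subseteq> C" "\<And>k. A k \<in> range ext" and "infinite K"
  shows "\<exists>K' B. infinite K' \<and> K' \<subseteq> K \<and> B \<subseteq> C \<and> B \<in> range ext \<and>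
    (\<forall>n. finite {k \<in> K'. tcard n (A k) \<noteq> tcard n B \<or> tcard n (C - A k) \<noteq> tcard n (C - B)})"
proof -
  consider (fin) a where "infinite {k \<in> K. finite (A k) \<and> card (A k) = a}"
    | (cofin) a where "infinite {k \<in> K. finite (C - A k) \<and> card (C - A k) = a}"
    | (unbounded) "\<And>a. finite {k \<in> K. finite (A k) \<and> card (A k) = a}"
        "\<And>a. finite {k \<in> K. finite (C - A k) \<and> card (C - A k) = a}"
    by blast
  then show ?thesis
  proof cases
    case fin
    let ?K = "{k \<in> K. finite (A k) \<and> card (A k) = a}"
    \<comment> \<open>Any term of the thinned sequence is its limit.\<close>
    obtain l where l: "l \<in> ?K" using fin by (metis ex_in_conv infinite_imp_nonempty)
    have "tcard n (A k) = tcard n (A l) \<and> tcard n (C - A k) = tcard n (C - A l)"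
      if "k \<in> ?K" for k n
      using that l A(1) by (auto simp: tcard_def card_Diff_subset)
    then have "{k \<in> ?K. tcard n (A k) \<noteq> tcard n (A l) \<or>
        tcard n (C - A k) \<noteq> tcard n (C - A l)} = {}" for n
      by blast
    then have "\<forall>n. finite {k \<in> ?K. tcard n (A k) \<noteq> tcard n (A l) \<or>
        tcard n (C - A k) \<noteq> tcard n (C - A l)}"
      by (metis finite.emptyI)
    then show ?thesis using fin A(1)[of l] A(2)[of l] by blast
  next
    case cofin
    let ?K = "{k \<in> K. finite (C - A k) \<and> card (C - A k) = a}"
    obtain l where l: "l \<in> ?K" using cofin by (metis ex_in_conv infinite_imp_nonempty)
    have A_eq: "A k = C - (C - A k)" for k using A(1) by auto
    have "tcard n (A k) = tcard n (A l) \<and> tcard n (C - A k) = tcard n (C - A l)"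
      if "k \<in> ?K" for k n
    proof -
      have "tcard n (C - (C - A k)) = tcard n (C - (C - A l))"
        using that l unfolding tcard_def
        by (auto simp: card_Diff_subset)
      then show ?thesis using that l A_eq by (simp add: tcard_def)
    qed
    then have "{k \<in> ?K. tcard n (A k) \<noteq> tcard n (A l) \<or>
        tcard n (C - A k) \<noteq> tcard n (C - A l)} = {}" for n
      by blast
    then have "\<forall>n. finite {k \<in> ?K. tcard n (A k) \<noteq> tcard n (A l) \<or>
        tcard n (C - A k) \<noteq> tcard n (C - A l)}"
      by (metis finite.emptyI)
    then show ?thesis using cofin A(1)[of l] A(2)[of l] by blast
  next
    case unbounded
    have bad: "finite {k \<in> K. tcard n (A k) \<noteq> n \<or> tcard n (C - A k) \<noteq> n}" for n
    proof (rule finite_subset)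
      have "tcard n X = n" if "\<And>a. a < n \<Longrightarrow> \<not> (finite X \<and> card X = a)" for X :: "'z set"
        using that[of "card X"] unfolding tcard_def by (cases "card X < n") auto
      then show "{k \<in> K. tcard n (A k) \<noteq> n \<or> tcard n (C - A k) \<noteq> n} \<subseteq>
        (\<Union>a<n. {k \<in> K. finite (A k) \<and> card (A k) = a} \<union>
                {k \<in> K. finite (C - A k) \<and> card (C - A k) = a})"
        by blast
      show "finite (\<Union>a<n. {k \<in> K. finite (A k) \<and> card (A k) = a} \<union>
                {k \<in> K. finite (C - A k) \<and> card (C - A k) = a})"
        by (intro finite_UN_I finite_UnI unbounded finite_lessThan)
    qed
    \<comment> \<open>Otherwise almost all \<open>A k\<close> would have more than
      \<open>card C\<close> points.\<close>
    have "infinite C"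
    proof
      assume "finite C"
      have "\<not> K \<subseteq> {k \<in> K. tcard (Suc (card C)) (A k) \<noteq> Suc (card C) \<or>
          tcard (Suc (card C)) (C - A k) \<noteq> Suc (card C)}"
        using finite_subset[OF _ bad[of "Suc (card C)"]] \<open>infinite K\<close> by blast
      then obtain k where "k \<in> K" "tcard (Suc (card C)) (A k) = Suc (card C)" by blast
      then show False
        using card_mono[OF \<open>finite C\<close> A(1)[of k]] finite_subset[OF A(1)[of k] \<open>finite C\<close>]
        unfolding tcard_def by simp
    qed
    \<comment> \<open>Any infinite piece with infinite remainder is a limit here, all truncated
      sizes being maximal. In the outer cell, two disjoint infinite members found one after the
      other provide the piece and an infinite part of the remainder.\<close>
    have "\<exists>B. B \<in> range ext \<and> B \<subseteq> C \<and> infinite B \<and> infinite (C - B)"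
      using C
    proof
      assume "C \<in> range ext"
      then show ?thesis using infinite_split[OF _ \<open>infinite C\<close>] by blast
    next
      assume co: "- C \<in> range ext"
      obtain D where D: "D \<in> range ext" "infinite D" "- C \<inter> D = {}"
        using infinite_outside[OF co] by (elim bexE conjE)
      obtain D' where "infinite D'" "(- C \<union> D) \<inter> D' = {}"
        using infinite_outside[OF range_Un[OF co D(1)]] by (elim bexE conjE)
      then have "infinite (C - D)" using finite_subset[of D' "C - D"] by blast
      then show ?thesis using D by blast
    qed
    then obtain B where B: "B \<in> range ext" "B \<subseteq> C" "infinite B" "infinite (C - B)" by blast
    have "tcard n B = n" "tcard n (C - B) = n" for n using B(3,4) by (auto simp: tcard_def)
    then show ?thesis using B bad \<open>infinite K\<close> by (intro exI[of _ K] exI[of _ B]) auto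
  qed
qed

text \<open>One thinning per cell. Discrepancies at finitely many indices are tolerated, a condition
  that survives the later thinnings.\<close>

lemma limit_in_cells:
  fixes A :: "'i \<Rightarrow> nat \<Rightarrow> 'z set"
  assumes "finite I"
    and C: "\<And>S. S \<in> I \<Longrightarrow> C S \<in> range ext \<or> - C S \<in> range ext"
    and A: "\<And>S k. S \<in> I \<Longrightarrow> A S k \<subseteq> C S" "\<And>S k. S \<in> I \<Longrightarrow> A S k \<in> range ext"
  shows "\<exists>K B. infinite K \<and> (\<forall>S\<in>I. B S \<subseteq> C S \<and> B S \<in> range ext \<and>
    (\<forall>n. finite {k \<in> K. tcard n (A S k) \<noteq> tcard n (B S) \<or>
      tcard n (C S - A S k) \<noteq> tcard n (C S - B S)}))"
  using assms
proof (induction I rule: finite_induct)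
  case empty
  then show ?case by (intro exI[of _ UNIV]) auto
next
  case (insert T I)
  have "\<exists>K B. infinite K \<and> (\<forall>S\<in>I. B S \<subseteq> C S \<and> B S \<in> range ext \<and>
    (\<forall>n. finite {k \<in> K. tcard n (A S k) \<noteq> tcard n (B S) \<or>
      tcard n (C S - A S k) \<noteq> tcard n (C S - B S)}))"
    by (rule insert.IH[OF insert.prems(1)[OF insertI2] insert.prems(2)[OF insertI2]
          insert.prems(3)[OF insertI2]])
  then obtain K B where "infinite K" and B: "\<forall>S\<in>I. B S \<subseteq> C S \<and> B S \<in> range ext \<and>
    (\<forall>n. finite {k \<in> K. tcard n (A S k) \<noteq> tcard n (B S) \<or>
      tcard n (C S - A S k) \<noteq> tcard n (C S - B S)})"
    by (elim exE conjE)
  obtain K' B' where "infinite K'" "K' \<subseteq> K" and B': "B' \<subseteq> C T" "B' \<in> range ext"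
    "\<forall>n. finite {k \<in> K'. tcard n (A T k) \<noteq> tcard n B' \<or>
      tcard n (C T - A T k) \<noteq> tcard n (C T - B')}"
    using limit_in_cell[where A = "A T", OF insert.prems(1)[OF insertI1]
        insert.prems(2)[OF insertI1] insert.prems(3)[OF insertI1] \<open>infinite K\<close>]
    by (elim exE conjE)
  have fin: "finite {k \<in> K'. P k}" if "finite {k \<in> K. P k}" for P
    using that by (rule rev_finite_subset) (use \<open>K' \<subseteq> K\<close> in auto)
  have "\<forall>S\<in>insert T I. (B(T := B')) S \<subseteq> C S \<and> (B(T := B')) S \<in> range ext \<and>
      (\<forall>n. finite {k \<in> K'. tcard n (A S k) \<noteq> tcard n ((B(T := B')) S) \<or>
        tcard n (C S - A S k) \<noteq> tcard n (C S - (B(T := B')) S)})"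
  proof
    fix S assume S: "S \<in> insert T I"
    show "(B(T := B')) S \<subseteq> C S \<and> (B(T := B')) S \<in> range ext \<and>
      (\<forall>n. finite {k \<in> K'. tcard n (A S k) \<noteq> tcard n ((B(T := B')) S) \<or>
        tcard n (C S - A S k) \<noteq> tcard n (C S - (B(T := B')) S)})"
    proof (cases "S = T")
      case True
      show ?thesis
        unfolding True fun_upd_same by (intro conjI B')
    next
      case False
      then have "S \<in> I" using S by simp
      then show ?thesis
        unfolding fun_upd_other[OF False]
        by (intro conjI allI fin) (use bspec[OF B \<open>S \<in> I\<close>] in simp_all)
    qed
  qed
  then show ?case using \<open>infinite K'\<close> by (intro exI conjI)
qed

end

text \<open>A countable language lets a type be exhausted by a sequence of finite subsets, those of
  its formulas with code at most \<open>k\<close>.\<close>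

instance fm :: countable
  by countable_datatype

context ring_of_sets_order
begin

text \<open>\<open>x k\<close> realizes the formulas with code at most \<open>k\<close>, and
  \<open>y\<close> is glued from the limits of the traces of \<open>x k\<close> on the cells. Each
  formula has one threshold, at which almost all \<open>x k\<close> with \<open>k\<close> in
  \<open>K\<close> are equivalent to \<open>y\<close>.\<close>

lemma omega_saturated: "omega_saturated le"
  unfolding omega_saturated_def
proof (intro allI impI)
  fix V :: "nat set" and v :: "nat \<Rightarrow> 'm" and p
  assume "finite V" and fv: "\<forall>\<phi>\<in>p. fv \<phi> \<subseteq> insert 0 V"
    and fin_sat: "\<forall>q\<subseteq>p. finite q \<longrightarrow> (\<exists>x. \<forall>\<phi>\<in>q. sat le (v(0 := x)) \<phi>)"
  \<comment> \<open>Variable 0 may occur in \<open>V\<close>, but its value under \<open>v\<close>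
    is overwritten and must not cut cells.\<close>
  define W where "W = V - {0}"
  have W: "finite W" "0 \<notin> W" "insert 0 V = insert 0 W" using \<open>finite V\<close> by (auto simp: W_def)
  have "\<exists>x. \<forall>\<phi>\<in>{\<phi> \<in> p. to_nat \<phi> \<le> k}. sat le (v(0 := x)) \<phi>" for k
  proof -
    have "finite {\<phi> \<in> p. to_nat \<phi> \<le> k}"
      by (rule finite_subset[OF _ finite_vimageI[of "{..k}" to_nat]]) auto
    then have "\<exists>x. \<forall>\<phi>\<in>{\<phi> \<in> p. to_nat \<phi> \<le> k}. sat le (v(0 := x)) \<phi>"
      by (intro fin_sat[rule_format]) auto
    then show ?thesis .
  qed
  then obtain x where x: "\<And>k \<phi>. \<phi> \<in> p \<Longrightarrow> to_nat \<phi> \<le> k \<Longrightarrow> sat le (v(0 := x k)) \<phi>"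
    by (metis (mono_tags, lifting) mem_Collect_eq)
  let ?C = "cell W v"
  have A: "?C S \<inter> ext (x k) \<in> range ext" for S k
  proof (cases "S = {}")
    case True
    have "?C {} \<inter> ext (x k) = ext (x k) - (- ?C {})" by auto
    then show ?thesis
      using True cell_range[OF W(1)] by (metis range_Diff rangeI)
  qed (use cell_range[OF W(1)] in \<open>auto intro!: range_Int\<close>)
  have C: "?C S \<in> range ext \<or> - ?C S \<in> range ext" for S
    using cell_range[OF W(1)] by (cases "S = {}") auto
  have "finite (Pow W)" using W(1) by simp
  then obtain K B where "infinite K" and B: "\<forall>S\<in>Pow W. B S \<subseteq> ?C S \<and> B S \<in> range ext \<and>
    (\<forall>n. finite {k \<in> K. tcard n (?C S \<inter> ext (x k)) \<noteq> tcard n (B S) \<or>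
      tcard n (?C S - ?C S \<inter> ext (x k)) \<noteq> tcard n (?C S - B S)})"
    using limit_in_cells[of "Pow W" ?C "\<lambda>S k. ?C S \<inter> ext (x k)"] A C by blast
  obtain y where y: "\<forall>S\<subseteq>W. ?C S \<inter> ext y = B S \<and> ?C S - ext y = ?C S - B S"
    using cells_glue[OF W(1), of B v] B by auto
  have "sat le (v(0 := y)) \<phi>" if "\<phi> \<in> p" for \<phi>
  proof -
    define n where "n = threshold \<phi>"
    let ?bad = "\<Union>S\<in>Pow W. {k \<in> K. tcard n (?C S \<inter> ext (x k)) \<noteq> tcard n (B S) \<or>
      tcard n (?C S - ?C S \<inter> ext (x k)) \<noteq> tcard n (?C S - B S)}"
    \<comment> \<open>Excluded are the indices at which some trace has not yet settled at level
      \<open>n\<close>, and those too small for \<phi> to be among the approximated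
      formulas.\<close>
    have "finite (?bad \<union> {..<to_nat \<phi>})" using B W(1) by auto
    then obtain k where k: "k \<in> K" "k \<notin> ?bad \<union> {..<to_nat \<phi>}"
      using \<open>infinite K\<close> by (meson finite_subset subsetI)
    have "cells_equiv n (insert 0 W) (v(0 := x k)) (v(0 := y))"
      using W(2)
    proof (rule cells_equiv_insertI)
      fix S assume "S \<subseteq> W"
      then show "tcard n (?C S \<inter> ext (x k)) = tcard n (?C S \<inter> ext y) \<and>
        tcard n (?C S - ext (x k)) = tcard n (?C S - ext y)"
        using k y by (auto simp: Diff_Int)
    qed
    moreover have "sat le (v(0 := x k)) \<phi>" using x[OF that, of k] k(2) by auto
    ultimately show ?thesis
      using sat_cells_equiv[of "insert 0 W" \<phi>] fv that W unfolding n_def by auto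
  qed
  then show "\<exists>x. \<forall>\<phi>\<in>p. sat le (v(0 := x)) \<phi>" by blast
qed

end


section \<open>Sets and numerals inside a model\<close>

locale basic_set_theory =
  fixes mem :: "'m \<Rightarrow> 'm \<Rightarrow> bool"  (infix "\<epsilon>" 50)
  assumes extensionality: "extensionality mem" and pairing: "pairing mem"
    and unions: "unions mem" and regularity: "regularity mem"
    and delta0_separation: "delta0 \<phi> \<Longrightarrow> separation_for mem \<phi>"
begin

definition elts :: "'m \<Rightarrow> 'm set" where
  "elts a = {x. x \<epsilon> a}"

lemma mem_elts_iff [simp]: "x \<in> elts a \<longleftrightarrow> x \<epsilon> a"
  by (simp add: elts_def)

lemma elts_inject [simp]: "elts a = elts b \<longleftrightarrow> a = b"
  using extensionality unfolding extensionality_def elts_def by blast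

lemma incl_iff: "incl mem a b \<longleftrightarrow> elts a \<subseteq> elts b"
  by (auto simp: incl_def)

lemma is_empty_iff: "is_empty mem a \<longleftrightarrow> elts a = {}"
  unfolding is_empty_def set_eq_iff by simp

lemma is_upair_iff: "is_upair mem p a b \<longleftrightarrow> elts p = {a, b}"
  unfolding is_upair_def set_eq_iff by simp

lemma is_succ_iff: "is_succ mem s a \<longleftrightarrow> elts s = insert a (elts a)"
  unfolding is_succ_def set_eq_iff by auto

lemma is_diff_iff: "is_diff mem c a b \<longleftrightarrow> elts c = elts a - elts b"
  unfolding is_diff_def set_eq_iff by simp

lemma range_eltsI:
  assumes "\<And>x. x \<epsilon> a \<longleftrightarrow> x \<in> A"
  shows "A \<in> range elts"
proof
  show "A = elts a" unfolding set_eq_iff using assms by simp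
qed simp

lemma separation_range:
  assumes "separation_for mem \<phi>"
  shows "{x. x \<epsilon> a \<and> sat mem (v(0 := x)) \<phi>} \<in> range elts"
proof -
  obtain b where "\<And>x. x \<epsilon> b \<longleftrightarrow> x \<epsilon> a \<and> sat mem (v(0 := x)) \<phi>"
    using assms unfolding separation_for_def by blast
  then show ?thesis by (intro range_eltsI[of b]) auto
qed

lemma range_Diff:
  assumes "A \<in> range elts" "B \<in> range elts"
  shows "A - B \<in> range elts"
proof -
  obtain a b where ab: "A = elts a" "B = elts b" using assms by blast
  have "delta0 (Neg (Rel 0 1))" by (intro delta0.intros)
  then have "{x. x \<epsilon> a \<and> sat mem (((\<lambda>_. b))(0 := x)) (Neg (Rel 0 1))} \<in> range elts"
    using delta0_separation separation_range by blast
  also have "{x. x \<epsilon> a \<and> sat mem (((\<lambda>_. b))(0 := x)) (Neg (Rel 0 1))} = A - B"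
    unfolding ab by auto
  finally show ?thesis .
qed

lemma range_Int: "A \<in> range elts \<Longrightarrow> B \<in> range elts \<Longrightarrow> A \<inter> B \<in> range elts"
  using range_Diff[of A "A - B"] range_Diff[of A B] by (simp add: Diff_Diff_Int)

lemma range_doubleton: "{a, b} \<in> range elts"
proof -
  obtain p where "is_upair mem p a b" using pairing unfolding pairing_def by blast
  then show ?thesis unfolding is_upair_iff by blast
qed

lemma range_Un:
  assumes "A \<in> range elts" "B \<in> range elts"
  shows "A \<union> B \<in> range elts"
proof -
  obtain a b where ab: "A = elts a" "B = elts b" using assms by blast
  obtain p where "elts p = {a, b}" using range_doubleton[of a b] by (metis imageE)
  then have p: "x \<epsilon> p \<longleftrightarrow> x = a \<or> x = b" for x by (auto simp flip: mem_elts_iff)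
  obtain u where "\<And>x. x \<epsilon> u \<longleftrightarrow> (\<exists>y. y \<epsilon> p \<and> x \<epsilon> y)"
    using unions unfolding unions_def by blast
  then show ?thesis unfolding ab by (intro range_eltsI[of u]) (auto simp: p)
qed

lemma range_finite:
  assumes "finite F"
  shows "F \<in> range elts"
  using assms
proof (induction F rule: finite_induct)
  case empty
  \<comment> \<open>The empty set arises as an arbitrary set minus itself.\<close>
  show ?case using range_Diff[of "elts undefined" "elts undefined"] by simp
next
  case (insert x F)
  then show ?case using range_Un[of "{x, x}" F] range_doubleton[of x x] by simp
qed

lemma finite_set_exists:
  assumes "finite F"
  obtains a where "elts a = F"
  using range_finite[OF assms] by (elim imageE) simp

lemma mem_irrefl: "\<not> a \<epsilon> a"
proof -
  obtain s where s: "elts s = {a}" using finite_set_exists[of "{a}"] by blast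
  then have "\<not> is_empty mem s" by (simp add: is_empty_iff)
  then obtain x where "x \<epsilon> s" "\<not> (\<exists>y. y \<epsilon> x \<and> y \<epsilon> s)"
    using regularity unfolding regularity_def by blast
  then show ?thesis using s by (auto simp flip: mem_elts_iff)
qed

lemma mem_asym: "a \<epsilon> b \<Longrightarrow> \<not> b \<epsilon> a"
proof
  assume ab: "a \<epsilon> b" "b \<epsilon> a"
  obtain s where s: "elts s = {a, b}" using finite_set_exists[of "{a, b}"] by blast
  then have "\<not> is_empty mem s" by (simp add: is_empty_iff)
  then obtain x where "x \<epsilon> s" "\<not> (\<exists>y. y \<epsilon> x \<and> y \<epsilon> s)"
    using regularity unfolding regularity_def by blast
  then show False using s ab by (auto simp flip: mem_elts_iff)
qed

definition of_set :: "'m set \<Rightarrow> 'm" where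
  "of_set A = (SOME a. elts a = A)"

lemma elts_of_set: "A \<in> range elts \<Longrightarrow> elts (of_set A) = A"
  unfolding of_set_def by (rule someI_ex) auto

definition pair :: "'m \<Rightarrow> 'm \<Rightarrow> 'm" where
  "pair a b = of_set {of_set {a, a}, of_set {a, b}}"

lemma is_opair_iff: "is_opair mem p a b \<longleftrightarrow> p = pair a b"
proof -
  have eq: "elts p = {a, b} \<longleftrightarrow> p = of_set {a, b}" for p a b
    using elts_of_set[OF range_doubleton, of a b] elts_inject[of p "of_set {a, b}"] by simp
  show ?thesis unfolding is_opair_def is_upair_iff pair_def eq by blast
qed

lemma pair_inject: "pair a b = pair c d \<longleftrightarrow> a = c \<and> b = d"
proof
  have upair: "of_set {a, b} = of_set {c, d} \<longleftrightarrow> {a, b} = {c, d}" for a b c d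
    using elts_of_set[OF range_doubleton, of a b] elts_of_set[OF range_doubleton, of c d]
    by metis
  assume "pair a b = pair c d"
  then show "a = c \<and> b = d"
    unfolding pair_def upair doubleton_eq_iff by auto
qed simp

section \<open>Standard numerals and external finiteness\<close>

primrec num :: "nat \<Rightarrow> 'm" where
  "num 0 = of_set {}"
| "num (Suc n) = of_set (insert (num n) (elts (num n)))"

lemma elts_num: "elts (num n) = num ` {..<n}"
proof (induction n)
  case 0
  then show ?case by (simp add: elts_of_set range_finite)
next
  case (Suc n)
  then have "finite (insert (num n) (elts (num n)))" by simp
  then have "elts (num (Suc n)) = insert (num n) (elts (num n))"
    by (simp add: elts_of_set range_finite)
  then show ?case using Suc by (simp add: lessThan_Suc)
qed

lemma num_mem_num: "num i \<epsilon> num j \<longleftrightarrow> num i \<in> num ` {..<j}"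
  by (simp flip: elts_num del: num.simps)

lemma inj_num: "inj num"
proof (rule linorder_injI)
  fix i j :: nat assume "i < j"
  then have "num i \<epsilon> num j" by (simp add: num_mem_num)
  then show "num i \<noteq> num j" using mem_irrefl by metis
qed

lemma num_mem_num_iff: "num i \<epsilon> num j \<longleftrightarrow> i < j"
  unfolding num_mem_num using inj_num by (auto dest: injD)

lemma mem_num_iff: "x \<epsilon> num n \<longleftrightarrow> (\<exists>i<n. x = num i)"
  using mem_elts_iff[of x "num n"] unfolding elts_num by blast

lemma card_elts_num: "card (elts (num n)) = n"
  unfolding elts_num by (subst card_image) (auto intro: inj_on_subset[OF inj_num])

lemma is_natural_num: "is_natural mem (num n)"
proof -
  have trans: "is_transitive mem (num k)" for k
    unfolding is_transitive_def incl_def mem_num_iff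
    using mem_num_iff by (meson less_trans)
  have "is_empty mem (num k) \<or> (\<exists>m. is_succ mem (num k) m)" for k
  proof (cases k)
    case 0
    then show ?thesis by (simp add: is_empty_iff elts_num del: num.simps)
  next
    case (Suc j)
    then have "is_succ mem (num k) (num j)"
      by (simp add: is_succ_iff elts_num lessThan_Suc del: num.simps)
    then show ?thesis by blast
  qed
  then show ?thesis
    unfolding is_natural_def is_ordinal_def mem_num_iff using trans by blast
qed

lemma natural_mem: "is_natural mem n \<Longrightarrow> m \<epsilon> n \<Longrightarrow> is_natural mem m"
  unfolding is_natural_def is_ordinal_def is_transitive_def incl_def by blast

lemma natural_cases:
  assumes "is_natural mem n"
  obtains "elts n = {}" | m where "is_natural mem m" "m \<epsilon> n" "elts n = insert m (elts m)"
proof -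
  consider "is_empty mem n" | m where "is_succ mem n m"
    using assms unfolding is_natural_def by blast
  then show ?thesis
  proof cases
    case 1
    then show ?thesis using that(1) by (simp add: is_empty_iff)
  next
    case (2 m)
    then have "elts n = insert m (elts m)" by (simp add: is_succ_iff)
    then have "m \<epsilon> n" by (metis insertI1 mem_elts_iff)
    then show ?thesis using that(2) natural_mem assms \<open>elts n = _\<close> by blast
  qed
qed

text \<open>Passing to the predecessor lowers the external size. Thus every nonstandard natural is
  externally infinite.\<close>

lemma finite_natural:
  assumes "is_natural mem n" "finite (elts n)"
  shows "n \<in> range num"
  using assms
proof (induction "card (elts n)" arbitrary: n rule: less_induct)
  case less
  from less.prems(1) show ?case
  proof (cases rule: natural_cases)
    case 1
    then have "elts n = elts (num 0)" by (simp add: elts_num del: num.simps)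
    then show ?thesis by (metis elts_inject rangeI)
  next
    case (2 m)
    have "card (elts m) < card (elts n)" "finite (elts m)"
      using 2(3) less.prems(2) mem_irrefl[of m] by auto
    then obtain k where "m = num k" using less.hyps 2(1) by blast
    then have "elts n = elts (num (Suc k))"
      using 2(3) by (simp add: elts_num lessThan_Suc del: num.simps)
    then show ?thesis by (metis elts_inject rangeI)
  qed
qed

text \<open>Otherwise the naturals are exactly the numerals, their order copies that of
  \<open>nat\<close>, and the size of the extension is a rank witnessing well-foundedness.\<close>

lemma omega_nonstandard_infinite_natural:
  assumes "omega_nonstandard mem"
  shows "\<exists>n. is_natural mem n \<and> infinite (elts n)"
proof (rule ccontr)
  assume "\<not> ?thesis"
  then have naturals: "is_natural mem n \<longleftrightarrow> n \<in> range num" for n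
    using finite_natural is_natural_num by blast
  let ?N = "{n. is_natural mem n}"
  let ?r = "{(m, n). is_natural mem m \<and> is_natural mem n \<and> (m \<epsilon> n \<or> m = n)}"
  have r: "(num i, num j) \<in> ?r \<longleftrightarrow> i \<le> j" for i j
    using inj_num by (auto simp: is_natural_num num_mem_num_iff dest: injD)
  have r_cases: "\<exists>i j. x = num i \<and> y = num j" if "(x, y) \<in> ?r" for x y
    using that naturals by auto
  have "refl_on ?N ?r" by (simp add: refl_on_def)
  moreover have "?r \<subseteq> ?N \<times> ?N" by auto
  moreover have "trans ?r"
  proof (rule transI)
    fix x y z assume xyz: "(x, y) \<in> ?r" "(y, z) \<in> ?r"
    obtain i j where ij: "x = num i" "y = num j" using r_cases[OF xyz(1)] by blast
    obtain k where k: "z = num k" using r_cases[OF xyz(2)] by blast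
    have "i \<le> j" "j \<le> k" using xyz unfolding ij k r by simp_all
    then show "(x, z) \<in> ?r" unfolding ij k r by simp
  qed
  moreover have "antisym ?r"
  proof (rule antisymI)
    fix x y assume "(x, y) \<in> ?r" "(y, x) \<in> ?r"
    then show "x = y" using mem_asym by auto
  qed
  moreover have "total_on ?N ?r"
  proof (rule total_onI)
    fix x y assume "x \<in> ?N" "y \<in> ?N"
    then obtain i j where ij: "x = num i" "y = num j" using naturals by auto
    show "(x, y) \<in> ?r \<or> (y, x) \<in> ?r" unfolding ij r by linarith
  qed
  moreover have "wf (?r - Id)"
  proof (rule wf_subset)
    show "wf (measure (\<lambda>n. card (elts n)))" by simp
    show "?r - Id \<subseteq> measure (\<lambda>n. card (elts n))"
    proof
      fix p assume p: "p \<in> ?r - Id"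
      obtain x y where "p = (x, y)" by (cases p)
      then obtain i j where ij: "p = (num i, num j)" using p r_cases[of x y] by blast
      have "(num i, num j) \<in> ?r" "i \<noteq> j" using p unfolding ij by auto
      then have "i \<noteq> j" "i \<le> j" unfolding r by simp_all
      then show "p \<in> measure (\<lambda>n. card (elts n))" unfolding ij by (simp add: card_elts_num)
    qed
  qed
  ultimately show False
    using assms unfolding omega_nonstandard_def order_on_defs by blast
qed

text \<open>Induction in the metatheory puts every \<open>num n\<close> into such a set, and these
  are distinct.\<close>

lemma infinity_infinite_set:
  assumes "infinity mem"
  shows "\<exists>w. infinite (elts w)"
proof -
  obtain w where w: "\<exists>z. is_empty mem z \<and> z \<epsilon> w"
    "\<And>x. x \<epsilon> w \<Longrightarrow> \<exists>s. is_succ mem s x \<and> s \<epsilon> w"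
    using assms unfolding infinity_def by blast
  have "num n \<epsilon> w" for n
  proof (induction n)
    case 0
    obtain z where "elts z = {}" "z \<epsilon> w" using w(1) by (auto simp: is_empty_iff)
    then have "elts z = elts (num 0)" by (simp add: elts_num del: num.simps)
    then show ?case using \<open>z \<epsilon> w\<close> by (metis elts_inject)
  next
    case (Suc n)
    then obtain s where "elts s = insert (num n) (elts (num n))" "s \<epsilon> w"
      using w(2) by (auto simp: is_succ_iff)
    then have "elts s = elts (num (Suc n))" by (simp add: elts_num lessThan_Suc del: num.simps)
    then show ?case using \<open>s \<epsilon> w\<close> by (metis elts_inject)
  qed
  then have "range num \<subseteq> elts w" by auto
  then have "infinite (elts w)"
    using finite_subset finite_imageD[OF _ inj_num] infinite_UNIV_nat by blast
  then show ?thesis by (rule exI[of _ w])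
qed

text \<open>The witness disjoint from \<open>u\<close> consists of the sets \<open>{x, u}\<close> with \<open>x\<close> in an infinite set:
  by regularity none of them lies in \<open>u\<close>.\<close>

lemma mereology_and_saturation:
  assumes pairs: "\<And>w u. \<exists>b. \<forall>x. x \<epsilon> w \<longrightarrow> (\<exists>y. y \<epsilon> b \<and> is_upair mem y x u)"
    and "infinite (elts w)"
    and split: "\<And>c. infinite (elts c) \<Longrightarrow>
      \<exists>B\<in>range elts. B \<subseteq> elts c \<and> infinite B \<and> infinite (elts c - B)"
  shows "set_theoretic_mereology (incl mem) \<and> omega_saturated (incl mem)"
proof -
  have outside: "\<exists>B\<in>range elts. infinite B \<and> A \<inter> B = {}" if A: "A \<in> range elts" for A
  proof -
    obtain u where u: "A = elts u" using A by blast
    obtain b where b: "\<And>x. x \<epsilon> w \<Longrightarrow> \<exists>y. y \<epsilon> b \<and> elts y = {x, u}"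
      using pairs[of w u] unfolding is_upair_iff by blast
    \<comment> \<open>\<open>b\<close> may contain more than the wanted pairs. Cutting it down to
      the members that contain \<open>u\<close> is enough, since no such member belongs to
      \<open>u\<close>.\<close>
    have "delta0 (Rel 1 0)" by (intro delta0.intros)
    then have "{y. y \<epsilon> b \<and> sat mem (((\<lambda>_. u))(0 := y)) (Rel 1 0)} \<in> range elts"
      using delta0_separation separation_range by blast
    then have range: "{y \<in> elts b. u \<epsilon> y} \<in> range elts" by simp
    obtain f where f: "\<And>x. x \<epsilon> w \<Longrightarrow> f x \<epsilon> b \<and> elts (f x) = {x, u}" using b by metis
    have "inj_on f (elts w)"
    proof (rule inj_onI)
      fix x y assume "x \<in> elts w" "y \<in> elts w" "f x = f y"
      then have "{x, u} = {y, u}" using f by (metis mem_elts_iff)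
      then show "x = y" by (auto simp: doubleton_eq_iff)
    qed
    moreover have "f ` elts w \<subseteq> {y \<in> elts b. u \<epsilon> y}"
      using f by (auto simp flip: mem_elts_iff)
    ultimately have "infinite {y \<in> elts b. u \<epsilon> y}"
      using \<open>infinite (elts w)\<close> finite_subset finite_image_iff by metis
    moreover have "A \<inter> {y \<in> elts b. u \<epsilon> y} = {}" using mem_asym u by auto
    ultimately show ?thesis using range by blast
  qed
  interpret ring_of_sets_order "incl mem" elts
    using split outside
    by unfold_locales (auto simp: incl_iff intro: range_finite range_Un range_Diff)
  show ?thesis using set_theoretic_mereology omega_saturated by blast
qed

end


section \<open>Formulas of set theory\<close>

abbreviation Disj :: "fm \<Rightarrow> fm \<Rightarrow> fm" where
  "Disj \<phi> \<psi> \<equiv> Neg (Conj (Neg \<phi>) (Neg \<psi>))"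

abbreviation Imp :: "fm \<Rightarrow> fm \<Rightarrow> fm" where
  "Imp \<phi> \<psi> \<equiv> Neg (Conj \<phi> (Neg \<psi>))"

abbreviation Forall :: "nat \<Rightarrow> fm \<Rightarrow> fm" where
  "Forall i \<phi> \<equiv> Neg (Ex i (Neg \<phi>))"

text \<open>The formulas below bind the variables 10 to 12, 20, 21 and 30; the bounds on variable names
  in the \<open>sat_fm\<close> lemmas keep the arguments clear of them.\<close>

definition fm_upair :: "nat \<Rightarrow> nat \<Rightarrow> nat \<Rightarrow> fm" where
  "fm_upair p a b = Conj (Rel a p) (Conj (Rel b p)
    (Neg (Ex 30 (Conj (Rel 30 p) (Conj (Neg (Eq 30 a)) (Neg (Eq 30 b)))))))"

definition fm_opair :: "nat \<Rightarrow> nat \<Rightarrow> nat \<Rightarrow> fm" where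
  "fm_opair p a b = Ex 20 (Ex 21 (Conj (fm_upair 20 a a) (Conj (fm_upair 21 a b) (fm_upair p 20 21))))"

definition fm_tagged :: "nat \<Rightarrow> nat \<Rightarrow> nat \<Rightarrow> fm" where
  "fm_tagged f k x = Ex 10 (Conj (Rel 10 f) (Conj (fm_opair 10 k x)
    (Forall 11 (Forall 12 (Imp (Conj (Rel 12 f) (fm_opair 12 11 x)) (Eq 11 k))))))"

definition fm_point_extension :: "nat \<Rightarrow> nat \<Rightarrow> nat \<Rightarrow> fm" where
  "fm_point_extension c X Z = Ex 20 (Conj (Rel 20 c) (Conj (Neg (Rel 20 X))
    (Conj (Rel 20 Z) (Forall 21 (Conj (Imp (Rel 21 X) (Rel 21 Z))
      (Imp (Rel 21 Z) (Disj (Eq 21 20) (Rel 21 X))))))))"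

text \<open>Needed for collection in KP. The other formulas built here go only to foundation or to
  the full separation of ZFC, so their quantifiers may be unbounded.\<close>

lemma delta0_fm_upair: "p < 30 \<Longrightarrow> delta0 (fm_upair p a b)"
  unfolding fm_upair_def by (intro delta0.intros) auto

lemma sat_fm_upair:
  "p < 30 \<Longrightarrow> a < 30 \<Longrightarrow> b < 30 \<Longrightarrow> sat mem v (fm_upair p a b) \<longleftrightarrow> is_upair mem (v p) (v a) (v b)"
  unfolding fm_upair_def is_upair_def by auto

lemma sat_fm_opair:
  "p < 20 \<Longrightarrow> a < 20 \<Longrightarrow> b < 20 \<Longrightarrow> sat mem v (fm_opair p a b) \<longleftrightarrow> is_opair mem (v p) (v a) (v b)"
  unfolding fm_opair_def is_opair_def by (simp add: sat_fm_upair)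

text \<open>Uniqueness runs from points to tags only: one \<open>f\<close> can give the same tag to
  a point inside and a point outside a set, while points with different tags are distinct.\<close>

definition tagged :: "('m \<Rightarrow> 'm \<Rightarrow> bool) \<Rightarrow> 'm \<Rightarrow> 'm \<Rightarrow> 'm \<Rightarrow> bool" where
  "tagged mem f k x \<longleftrightarrow> (\<exists>p. mem p f \<and> is_opair mem p k x \<and>
    (\<forall>k' p'. mem p' f \<and> is_opair mem p' k' x \<longrightarrow> k' = k))"

lemma sat_fm_tagged:
  "f < 10 \<Longrightarrow> k < 10 \<Longrightarrow> x < 10 \<Longrightarrow> sat mem v (fm_tagged f k x) \<longleftrightarrow> tagged mem (v f) (v k) (v x)"
  unfolding fm_tagged_def tagged_def by (simp add: sat_fm_opair) blast

definition point_extension :: "('m \<Rightarrow> 'm \<Rightarrow> bool) \<Rightarrow> 'm \<Rightarrow> 'm \<Rightarrow> 'm \<Rightarrow> bool" where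
  "point_extension mem c X Z \<longleftrightarrow> (\<exists>x. mem x c \<and> \<not> mem x X \<and> mem x Z \<and>
    (\<forall>y. (mem y X \<longrightarrow> mem y Z) \<and> (mem y Z \<longrightarrow> y = x \<or> mem y X)))"

lemma sat_fm_point_extension:
  "c < 20 \<Longrightarrow> X < 20 \<Longrightarrow> Z < 20 \<Longrightarrow>
    sat mem v (fm_point_extension c X Z) \<longleftrightarrow> point_extension mem (v c) (v X) (v Z)"
  unfolding fm_point_extension_def point_extension_def by auto


section \<open>Splitting infinite sets\<close>

text \<open>The form of foundation common to ZF and KP. For classes bounded by a set, regularity and
  separation suffice; the usual derivation of the full scheme would need transitive
  closures.\<close>

definition local_foundation :: "('m \<Rightarrow> 'm \<Rightarrow> bool) \<Rightarrow> bool" where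
  "local_foundation mem \<longleftrightarrow> (\<forall>\<phi> v a. (\<forall>x. sat mem (v(0 := x)) \<phi> \<longrightarrow> mem x a) \<longrightarrow>
      (\<exists>x. sat mem (v(0 := x)) \<phi>) \<longrightarrow>
      (\<exists>x. sat mem (v(0 := x)) \<phi> \<and> (\<forall>y. mem y x \<longrightarrow> \<not> sat mem (v(0 := y)) \<phi>)))"

context basic_set_theory
begin

definition splits :: "'m \<Rightarrow> bool" where
  "splits c \<longleftrightarrow> (\<exists>B\<in>range elts. B \<subseteq> elts c \<and> infinite B \<and> infinite (elts c - B))"

text \<open>Overspill: for finite \<open>n\<close> there are \<open>b\<close> and \<open>f\<close> such that \<open>f\<close> injects \<open>n\<close> both into
  \<open>c \<inter> b\<close> and into \<open>c - b\<close>; a least failure at a natural number below an infinite one would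
  have an infinite predecessor.\<close>

lemma splits_if_infinite_natural:
  assumes foundation: "local_foundation mem"
    and N: "is_natural mem N" "infinite (elts N)" and c: "infinite (elts c)"
  shows "splits c"
proof -
  define P where "P n \<longleftrightarrow> (\<exists>b f. \<forall>k. k \<epsilon> n \<longrightarrow> (\<exists>x. x \<epsilon> c \<and> x \<epsilon> b \<and> tagged mem f k x) \<and>
    (\<exists>x. x \<epsilon> c \<and> \<not> x \<epsilon> b \<and> tagged mem f k x))" for n
  have P_finite: "P n" if n: "finite (elts n)" for n
  proof -
    obtain A where A: "A \<subseteq> elts c" "finite A" "card A = card (elts n)"
      using infinite_arbitrarily_large[OF c, of "card (elts n)"] by (elim exE conjE)
    have "infinite (elts c - A)" using c A(2) by simp
    from infinite_arbitrarily_large[OF this, of "card (elts n)"]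
    obtain A' where A': "A' \<subseteq> elts c - A" "finite A'" "card A' = card (elts n)"
      by (elim exE conjE)
    obtain h where h: "bij_betw h (elts n) A"
      using finite_same_card_bij[OF n A(2)] A(3) by auto
    obtain h' where h': "bij_betw h' (elts n) A'"
      using finite_same_card_bij[OF n A'(2)] A'(3) by auto
    obtain b where b: "elts b = A" using finite_set_exists[OF A(2)] .
    have "finite ((\<lambda>k. pair k (h k)) ` elts n \<union> (\<lambda>k. pair k (h' k)) ` elts n)"
      using n by simp
    then obtain f where f: "elts f = (\<lambda>k. pair k (h k)) ` elts n \<union> (\<lambda>k. pair k (h' k)) ` elts n"
      by (rule finite_set_exists)
    have f_iff: "pair k x \<epsilon> f \<longleftrightarrow> k \<epsilon> n \<and> (x = h k \<or> x = h' k)" for k x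
      using f unfolding set_eq_iff by (simp add: image_iff Bex_def pair_inject) blast
    have h_in: "h k \<in> A" "h' k \<in> elts c - A" if "k \<epsilon> n" for k
      using that bij_betwE[OF h] subsetD[OF A'(1), of "h' k"] bij_betwE[OF h'] by auto
    then have disj: "h k \<noteq> h' l" if "k \<epsilon> n" "l \<epsilon> n" for k l
      using that by (metis Diff_iff)
    have inj: "h k = h l \<Longrightarrow> k = l" "h' k = h' l \<Longrightarrow> k = l" if "k \<epsilon> n" "l \<epsilon> n" for k l
      using that h h' unfolding bij_betw_def inj_on_def by auto
    have tagged: "tagged mem f k (h k)" "tagged mem f k (h' k)" if "k \<epsilon> n" for k
      unfolding tagged_def is_opair_iff using that by (auto simp: f_iff dest: inj disj disj[symmetric])
    have "h k \<epsilon> c \<and> h k \<epsilon> b" "h' k \<epsilon> c \<and> \<not> h' k \<epsilon> b" if "k \<epsilon> n" for k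
      using h_in[OF that] A(1) b by auto
    then show ?thesis unfolding P_def using tagged by blast
  qed
  have "\<exists>n. infinite (elts n) \<and> P n"
  proof (rule ccontr)
    assume no: "\<not> ?thesis"
    \<comment> \<open>The bounding set must contain \<open>N\<close> itself, the failure to start
      from.\<close>
    have "elts N \<union> {N} \<in> range elts" by (rule range_Un[OF rangeI range_finite]) simp
    then obtain a where a: "elts a = insert N (elts N)" by (elim imageE) simp
    \<comment> \<open>In \<phi>, variable 1 denotes \<open>c\<close> by default and 2 denotes the
      bound \<open>a\<close>.\<close>
    define v where "v = (\<lambda>_::nat. c)(2 := a)"
    define \<phi> where "\<phi> = Conj (Rel 0 2) (Neg (Ex 3 (Ex 4 (Forall 5 (Imp (Rel 5 0) (Conj
      (Ex 6 (Conj (Rel 6 1) (Conj (Rel 6 3) (fm_tagged 4 5 6))))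
      (Ex 6 (Conj (Rel 6 1) (Conj (Neg (Rel 6 3)) (fm_tagged 4 5 6))))))))))"
    have sat: "sat mem (v(0 := n)) \<phi> \<longleftrightarrow> n \<epsilon> a \<and> \<not> P n" for n
      unfolding \<phi>_def P_def v_def by (simp add: sat_fm_tagged)
    have "N \<epsilon> a" using a by (metis insertI1 mem_elts_iff)
    moreover have "\<not> P N" using no N(2) by blast
    ultimately have "\<exists>n. sat mem (v(0 := n)) \<phi>" unfolding sat by blast
    moreover have "\<forall>n. sat mem (v(0 := n)) \<phi> \<longrightarrow> n \<epsilon> a" unfolding sat by blast
    ultimately have "\<exists>n. sat mem (v(0 := n)) \<phi> \<and> (\<forall>m. m \<epsilon> n \<longrightarrow> \<not> sat mem (v(0 := m)) \<phi>)"
      using foundation unfolding local_foundation_def by blast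
    then obtain n where n: "n \<epsilon> a" "\<not> P n" and least: "\<And>m. m \<epsilon> n \<Longrightarrow> \<not> (m \<epsilon> a \<and> \<not> P m)"
      unfolding sat by blast
    have "n = N \<or> n \<epsilon> N" using n(1) a unfolding set_eq_iff by auto
    moreover have "n \<epsilon> N \<Longrightarrow> elts n \<subseteq> elts N"
      using N(1) unfolding is_natural_def is_ordinal_def is_transitive_def incl_iff by blast
    ultimately have "elts n \<subseteq> elts N" "is_natural mem n" using N(1) natural_mem by blast+
    then have sub: "elts n \<subseteq> elts a" using a by blast
    from \<open>is_natural mem n\<close> show False
    proof (cases rule: natural_cases)
      case 1
      then show False using n(2) P_finite[of n] by simp
    next
      case (2 m)
      then have "P m" using least sub by auto
      then have "finite (elts m)" using no by blast
      then show False using n(2) P_finite[of n] 2(3) by simp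
    qed
  qed
  then obtain n b f where n: "infinite (elts n)" and f:
    "\<And>k. k \<epsilon> n \<Longrightarrow> \<exists>x. x \<epsilon> c \<and> x \<epsilon> b \<and> tagged mem f k x"
    "\<And>k. k \<epsilon> n \<Longrightarrow> \<exists>x. x \<epsilon> c \<and> \<not> x \<epsilon> b \<and> tagged mem f k x"
    unfolding P_def by blast
  have inf: "infinite X" if X: "\<And>k. k \<epsilon> n \<Longrightarrow> \<exists>x\<in>X. tagged mem f k x" for X
  proof -
    obtain h where h: "\<And>k. k \<epsilon> n \<Longrightarrow> h k \<in> X \<and> tagged mem f k (h k)" using X by metis
    have "inj_on h (elts n)"
    proof (rule inj_onI)
      fix k l assume "k \<in> elts n" "l \<in> elts n" and eq: "h k = h l"
      then have "tagged mem f k (h k)" "tagged mem f l (h k)" using h[of k] h[of l] by simp_all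
      then show "k = l" unfolding tagged_def by blast
    qed
    moreover have "h ` elts n \<subseteq> X" using h by auto
    ultimately show ?thesis using n by (metis finite_imageD finite_subset)
  qed
  have "infinite (elts c \<inter> elts b)" "infinite (elts c - elts b)"
    by (rule inf; use f in \<open>simp add: Bex_def\<close>)+
  then show ?thesis
    unfolding splits_def
    by (intro bexI[of _ "elts c \<inter> elts b"] range_Int) (auto simp: Diff_Int)
qed

text \<open>An external bijection with a numeral is a finite set of pairs, hence a set of the
  model.\<close>

lemma is_finite_if_finite:
  assumes "finite (elts a)"
  shows "is_finite mem a"
proof -
  define n where "n = num (card (elts a))"
  have n: "finite (elts n)" "card (elts n) = card (elts a)"
    unfolding n_def card_elts_num by (simp_all add: elts_num)
  obtain h where "bij_betw h (elts n) (elts a)" using finite_same_card_bij[OF n(1) assms n(2)] by blast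
  then have img: "h ` elts n = elts a" and inj: "inj_on h (elts n)"
    unfolding bij_betw_def by blast+
  have h: "\<And>x y. x \<epsilon> n \<Longrightarrow> y \<epsilon> n \<Longrightarrow> h x = h y \<Longrightarrow> x = y" "\<And>x. x \<epsilon> n \<Longrightarrow> h x \<epsilon> a"
    "\<And>y. y \<epsilon> a \<Longrightarrow> \<exists>x. x \<epsilon> n \<and> h x = y"
    subgoal using inj by (simp add: inj_on_def)
    subgoal using img by (metis imageI mem_elts_iff)
    subgoal using img by (metis imageE mem_elts_iff)
    done
  obtain f where f: "elts f = (\<lambda>k. pair k (h k)) ` elts n"
    using finite_set_exists n(1) by (metis finite_imageI)
  then have f: "p \<epsilon> f \<longleftrightarrow> (\<exists>k. k \<epsilon> n \<and> p = pair k (h k))" for p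
    using mem_elts_iff[of p f] by (simp add: image_iff Bex_def)
  have "is_bijection mem f n a"
    unfolding is_bijection_def is_opair_iff f
  proof (intro conjI allI impI)
    fix p assume "\<exists>k. k \<epsilon> n \<and> p = pair k (h k)"
    then show "\<exists>x y. x \<epsilon> n \<and> y \<epsilon> a \<and> p = pair x y" using h(2) by blast
  next
    fix x assume "x \<epsilon> n"
    then show "\<exists>!y. \<exists>p. (\<exists>k. k \<epsilon> n \<and> p = pair k (h k)) \<and> p = pair x y"
      using pair_inject by (intro ex1I[of _ "h x"]) auto
  next
    fix y assume "y \<epsilon> a"
    then obtain x where "x \<epsilon> n" "h x = y" using h(3) by blast
    then show "\<exists>!x. \<exists>p. (\<exists>k. k \<epsilon> n \<and> p = pair k (h k)) \<and> p = pair x y"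
      using pair_inject h(1) by (intro ex1I[of _ x]) auto
  qed
  then show ?thesis unfolding is_finite_def n_def using is_natural_num by blast
qed

text \<open>With standard naturals, an internal bijection would make \<open>c\<close> externally
  finite, so \<open>c\<close> is internally infinite and the failure of amorphousness applies. The
  two pieces are externally infinite by \<open>is_finite_if_finite\<close>.\<close>

lemma splits_if_not_amorphous:
  assumes standard: "\<And>n. is_natural mem n \<Longrightarrow> finite (elts n)"
    and "\<not> amorphous mem c" and c: "infinite (elts c)"
  shows "splits c"
proof -
  have "\<not> is_finite mem c"
  proof
    assume "is_finite mem c"
    then obtain n f where "is_natural mem n" and f: "is_bijection mem f n c"
      unfolding is_finite_def by blast
    have "elts c \<subseteq> (\<lambda>x. THE y. \<exists>p. p \<epsilon> f \<and> is_opair mem p x y) ` elts n"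
    proof
      fix y assume "y \<in> elts c"
      then obtain x p where p: "p \<epsilon> f" "is_opair mem p x y"
        using f unfolding is_bijection_def by (metis mem_elts_iff)
      then have "x \<epsilon> n"
        using f unfolding is_bijection_def is_opair_iff by (metis pair_inject)
      then have "\<exists>!y. \<exists>p. p \<epsilon> f \<and> is_opair mem p x y"
        using f unfolding is_bijection_def by blast
      then have "(THE y. \<exists>p. p \<epsilon> f \<and> is_opair mem p x y) = y"
        using p by (intro the1_equality) auto
      then show "y \<in> (\<lambda>x. THE y. \<exists>p. p \<epsilon> f \<and> is_opair mem p x y) ` elts n"
        using \<open>x \<epsilon> n\<close> by (intro image_eqI[of _ _ x]) auto
    qed
    then show False
      using c standard[OF \<open>is_natural mem n\<close>] finite_surj by blast
  qed
  then obtain b where b: "incl mem b c" "\<not> is_finite mem b"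
    "\<And>d. is_diff mem d c b \<Longrightarrow> \<not> is_finite mem d"
    using \<open>\<not> amorphous mem c\<close> unfolding amorphous_def by blast
  have "elts c - elts b \<in> range elts" by (simp add: range_Diff)
  then obtain d where d: "elts d = elts c - elts b" by (elim imageE) simp
  then have "infinite (elts d)" using b(3) is_finite_if_finite by (auto simp: is_diff_iff)
  moreover have "infinite (elts b)" using b(2) is_finite_if_finite by auto
  ultimately show ?thesis
    unfolding splits_def using b(1) d by (intro bexI[of _ "elts b"]) (auto simp: incl_iff)
qed

end

context basic_set_theory
begin

lemma point_extension_iff:
  "point_extension mem c X Z \<longleftrightarrow> (\<exists>x. x \<epsilon> c \<and> \<not> x \<epsilon> X \<and> elts Z = insert x (elts X))"
  unfolding point_extension_def set_eq_iff by (simp add: mem_elts_iff) blast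

text \<open>The edges \<open>{X, Z}\<close> with \<open>Z = X \<union> {x}\<close> and fixed \<open>X\<close> form pairwise disjoint families,
  so that choice selects for every proper subset \<open>X\<close> of \<open>c\<close> a one-point extension.\<close>

lemma point_extension_selector:
  assumes separation: "\<And>\<phi>. separation_for mem \<phi>" and power_sets: "power_sets mem"
    and choice: "choice mem"
  shows "\<exists>C. \<forall>X. incl mem X c \<and> X \<noteq> c \<longrightarrow>
    (\<exists>!Z. \<exists>e. e \<epsilon> C \<and> is_upair mem e X Z \<and> point_extension mem c X Z)"
proof -
  have power: "\<exists>p. \<forall>x. x \<epsilon> p \<longleftrightarrow> incl mem x a" for a
    using power_sets unfolding power_sets_def by blast
  \<comment> \<open>Subsets of \<open>c\<close> lie in \<open>p\<close>, edges in \<open>pp\<close>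
    and families of edges in \<open>ppp\<close>, so separation suffices to form everything
    below.\<close>
  obtain p where p: "\<And>x. x \<epsilon> p \<longleftrightarrow> incl mem x c" using power[of c] by blast
  obtain pp where pp: "\<And>x. x \<epsilon> pp \<longleftrightarrow> incl mem x p" using power[of p] by blast
  obtain ppp where ppp: "\<And>x. x \<epsilon> ppp \<longleftrightarrow> incl mem x pp" using power[of pp] by blast
  define edge where "edge X e \<longleftrightarrow> (\<exists>Z. is_upair mem e X Z \<and> point_extension mem c X Z)" for X e
  \<comment> \<open>The base is the smaller end of an edge: a crosswise match would give
    \<open>X\<close> strictly inside \<open>Z = Y\<close>, strictly inside
    \<open>W = X\<close>.\<close>
  have edge_unique: "X = Y" if e: "edge X e" "edge Y e" for X Y e
  proof -
    obtain Z W where ZW: "elts e = {X, Z}" "elts e = {Y, W}"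
      "point_extension mem c X Z" "point_extension mem c Y W"
      using e unfolding edge_def is_upair_iff by blast
    then have "elts X \<subset> elts Z" "elts Y \<subset> elts W"
      unfolding point_extension_iff by (metis insertI1 mem_elts_iff psubsetI subset_insertI)+
    moreover have "X = Y \<or> X = W \<and> Z = Y" using ZW(1,2) by (metis doubleton_eq_iff)
    ultimately show ?thesis by blast
  qed
  have edge_pp: "e \<epsilon> pp" if e: "edge X e" "X \<epsilon> p" for X e
  proof -
    obtain Z x where Z: "elts e = {X, Z}" "x \<epsilon> c" "elts Z = insert x (elts X)"
      using e(1) unfolding edge_def is_upair_iff point_extension_iff by blast
    then have "Z \<epsilon> p" using e(2) unfolding p incl_iff by (metis insert_subset mem_elts_iff)
    then show ?thesis unfolding pp incl_iff Z(1) using e(2) by simp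
  qed
  define edge_fm where "edge_fm = (\<lambda>X e. Ex 5 (Conj (fm_upair e X 5) (fm_point_extension 2 X 5)))"
  have sat_edge: "sat mem v (edge_fm X e) \<longleftrightarrow> edge (v X) (v e)" if "X < 20" "e < 20" "X \<noteq> 5" "e \<noteq> 5" "v 2 = c" for v X e
    using that unfolding edge_fm_def edge_def by (simp add: sat_fm_upair sat_fm_point_extension)
  have "\<exists>Y. \<forall>e. e \<epsilon> Y \<longleftrightarrow> e \<epsilon> pp \<and> edge X e" for X
  proof -
    obtain Y where "\<And>e. e \<epsilon> Y \<longleftrightarrow> e \<epsilon> pp \<and> sat mem (((\<lambda>_. c)(1 := X))(0 := e)) (edge_fm 1 0)"
      using separation[of "edge_fm 1 0"] unfolding separation_for_def by blast
    then have "\<forall>e. e \<epsilon> Y \<longleftrightarrow> e \<epsilon> pp \<and> edge X e" by (simp add: sat_edge)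
    then show ?thesis by (rule exI[of _ Y])
  qed
  then obtain Y where Y: "\<And>X e. e \<epsilon> Y X \<longleftrightarrow> e \<epsilon> pp \<and> edge X e" by metis
  \<comment> \<open>This says that variable 0 is \<open>Y X\<close> for a proper subset
    \<open>X\<close> of \<open>c\<close>. The set \<open>c\<close> itself has no extension; its
    empty family must be kept away from choice.\<close>
  define \<phi> where "\<phi> = Ex 1 (Conj (Rel 1 3) (Conj (Neg (Eq 1 2))
    (Forall 6 (Conj (Imp (Rel 6 0) (Conj (Rel 6 4) (edge_fm 1 6)))
      (Imp (Conj (Rel 6 4) (edge_fm 1 6)) (Rel 6 0))))))"
  have sat_\<phi>: "sat mem (((\<lambda>_. c)(3 := p, 4 := pp))(0 := y)) \<phi> \<longleftrightarrow>
      (\<exists>X. X \<epsilon> p \<and> X \<noteq> c \<and> y = Y X)" for y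
  proof -
    have "y = Y X \<longleftrightarrow> (\<forall>e. (e \<epsilon> y \<longrightarrow> e \<epsilon> pp \<and> edge X e) \<and> (e \<epsilon> pp \<longrightarrow> edge X e \<longrightarrow> e \<epsilon> y))" for X
      unfolding elts_inject[symmetric] set_eq_iff mem_elts_iff Y by blast
    then show ?thesis
      unfolding \<phi>_def by (simp add: sat_edge)
  qed
  obtain a where
    "\<And>y. y \<epsilon> a \<longleftrightarrow> y \<epsilon> ppp \<and> sat mem (((\<lambda>_. c)(3 := p, 4 := pp))(0 := y)) \<phi>"
    using separation[of \<phi>] unfolding separation_for_def by blast
  then have a: "y \<epsilon> a \<longleftrightarrow> y \<epsilon> ppp \<and> (\<exists>X. X \<epsilon> p \<and> X \<noteq> c \<and> y = Y X)" for y
    unfolding sat_\<phi> by simp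
  have Y_ppp: "Y X \<epsilon> ppp" for X unfolding ppp incl_def Y by blast
  have nonempty: "\<not> is_empty mem y" if y: "y \<epsilon> a" for y
  proof -
    obtain X where X: "X \<epsilon> p" "X \<noteq> c" "y = Y X" using y a by blast
    then have "\<not> elts c \<subseteq> elts X" using p incl_iff elts_inject by (metis subset_antisym)
    then obtain x where x: "x \<epsilon> c" "\<not> x \<epsilon> X" unfolding subset_iff mem_elts_iff by blast
    have "elts X \<union> {x} \<in> range elts" by (rule range_Un[OF rangeI range_finite]) simp
    then obtain Z where Z: "elts Z = insert x (elts X)" by (elim imageE) simp
    obtain e where e: "elts e = {X, Z}" using finite_set_exists[of "{X, Z}"] by blast
    then have "edge X e" unfolding edge_def is_upair_iff point_extension_iff using x Z by blast
    then have "e \<epsilon> y" unfolding X(3) Y using edge_pp X(1) by blast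
    then show ?thesis unfolding is_empty_def by blast
  qed
  have disjoint: "\<not> (\<exists>e. e \<epsilon> y \<and> e \<epsilon> z)" if yz: "y \<epsilon> a \<and> z \<epsilon> a \<and> y \<noteq> z" for y z
  proof
    assume "\<exists>e. e \<epsilon> y \<and> e \<epsilon> z"
    then obtain e where e: "e \<epsilon> y" "e \<epsilon> z" by blast
    obtain X X' where "y = Y X" "z = Y X'" using yz a by blast
    then show False using e yz edge_unique[of X e X'] Y by blast
  qed
  have "\<exists>C. \<forall>y. y \<epsilon> a \<longrightarrow> (\<exists>!e. e \<epsilon> C \<and> e \<epsilon> y)"
    by (rule choice[unfolded choice_def, rule_format]) (use nonempty disjoint in blast)+
  then obtain C where C: "\<And>y. y \<epsilon> a \<Longrightarrow> \<exists>!e. e \<epsilon> C \<and> e \<epsilon> y"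
    by (elim exE) blast
  show ?thesis
  proof (intro exI[of _ C] allI impI)
    fix X assume X: "incl mem X c \<and> X \<noteq> c"
    then have Xp: "X \<epsilon> p" by (simp add: p)
    have "Y X \<epsilon> a" unfolding a using Xp X Y_ppp by blast
    then have "\<exists>!e. e \<epsilon> C \<and> edge X e" using C[of "Y X"] Y edge_pp Xp by metis
    then obtain e where e: "e \<epsilon> C" "edge X e" "\<And>e'. e' \<epsilon> C \<Longrightarrow> edge X e' \<Longrightarrow> e' = e" by blast
    obtain Z where Z: "is_upair mem e X Z" "point_extension mem c X Z"
      using e(2) unfolding edge_def by blast
    show "\<exists>!Z. \<exists>e. e \<epsilon> C \<and> is_upair mem e X Z \<and> point_extension mem c X Z"
    proof (rule ex1I[of _ Z])
      show "\<exists>e. e \<epsilon> C \<and> is_upair mem e X Z \<and> point_extension mem c X Z" using e(1) Z by blast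
      fix W assume "\<exists>e. e \<epsilon> C \<and> is_upair mem e X W \<and> point_extension mem c X W"
      then have "is_upair mem e X W" using e(3) unfolding edge_def by blast
      then have "{X, W} = {X, Z}" using Z(1) unfolding is_upair_iff by simp
      then show "W = Z" by (metis doubleton_eq_iff)
    qed
  qed
qed

text \<open>Iterating the selected extensions from the empty set yields subsets \<open>X\<^sub>0 \<subset> X\<^sub>1 \<subset> \<dots>\<close> of \<open>c\<close>;
  \<open>b\<close> collects the points added at even stages. The even stages are described by a formula, as
  the members of every family that contains the empty set and is closed under two extensions.
  Such a family may have nonstandard members, but those contain every \<open>X\<^sub>n\<close>.\<close>

lemma splits_if_choice:
  assumes separation: "\<And>\<phi>. separation_for mem \<phi>" and power_sets: "power_sets mem"
    and choice: "choice mem" and c: "infinite (elts c)"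
  shows "splits c"
proof -
  obtain C where C: "\<And>X. incl mem X c \<and> X \<noteq> c \<longrightarrow>
    (\<exists>!Z. \<exists>e. e \<epsilon> C \<and> is_upair mem e X Z \<and> point_extension mem c X Z)"
    using point_extension_selector[OF separation power_sets choice] by blast
  define step where
    "step X Z \<longleftrightarrow> (\<exists>e. e \<epsilon> C \<and> is_upair mem e X Z \<and> point_extension mem c X Z)" for X Z
  have step_point: "\<exists>x. x \<epsilon> c \<and> \<not> x \<epsilon> X \<and> elts Z = insert x (elts X)" if "step X Z" for X Z
    using that unfolding step_def point_extension_iff by blast
  \<comment> \<open>The recursion is external. \<open>THE\<close> is well defined because
    \<open>X n\<close> stays finite and so differs from \<open>c\<close>.\<close>
  define X where "X = rec_nat (of_set {}) (\<lambda>_ Y. THE Z. step Y Z)"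
  have X_0: "elts (X 0) = {}" by (simp add: X_def elts_of_set range_finite)
  have X_finite: "finite (elts (X n)) \<and> elts (X n) \<subseteq> elts c" and X_step: "step (X n) Z \<longleftrightarrow> Z = X (Suc n)"
    for n Z
  proof -
    have step_iff: "step (X n) Z \<longleftrightarrow> Z = X (Suc n)" if "finite (elts (X n)) \<and> elts (X n) \<subseteq> elts c" for n Z
    proof -
      have "X n \<noteq> c" "incl mem (X n) c" using that c by (auto simp: incl_iff)
      then have ex1: "\<exists>!Z. step (X n) Z" using C[of "X n"] unfolding step_def by blast
      have "X (Suc n) = (THE Z. step (X n) Z)" by (simp add: X_def)
      then show ?thesis using theI'[OF ex1] ex1 by metis
    qed
    have fin: "finite (elts (X n)) \<and> elts (X n) \<subseteq> elts c" for n
    proof (induction n)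
      case 0
      then show ?case using X_0 by simp
    next
      case (Suc n)
      then obtain x where "x \<epsilon> c" "elts (X (Suc n)) = insert x (elts (X n))"
        using step_iff[of n "X (Suc n)"] step_point by blast
      then show ?case using Suc by simp
    qed
    then show "finite (elts (X n)) \<and> elts (X n) \<subseteq> elts c" .
    show "step (X n) Z \<longleftrightarrow> Z = X (Suc n)" by (rule step_iff[OF fin])
  qed
  have "\<exists>x. x \<epsilon> c \<and> \<not> x \<epsilon> X n \<and> elts (X (Suc n)) = insert x (elts (X n))" for n
    using X_step step_point by blast
  then obtain x where x: "\<And>n. x n \<epsilon> c" "\<And>n. \<not> x n \<epsilon> X n"
    "\<And>n. elts (X (Suc n)) = insert (x n) (elts (X n))"
    by metis
  have elts_X: "elts (X n) = x ` {..<n}" for n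
    by (induction n) (simp_all add: X_0 x(3) lessThan_Suc)
  have mem_X: "x m \<epsilon> X n \<longleftrightarrow> m < n" for m n
  proof
    assume mem: "x m \<epsilon> X n"
    show "m < n"
    proof (rule ccontr)
      assume "\<not> m < n"
      then have "elts (X n) \<subseteq> elts (X m)" unfolding elts_X by (intro image_mono) auto
      then show False using x(2)[of m] subsetD[of "elts (X n)" "elts (X m)" "x m"] mem by simp
    qed
  next
    assume "m < n"
    then have "x m \<in> elts (X n)" unfolding elts_X by blast
    then show "x m \<epsilon> X n" by simp
  qed
  have inj_x: "inj x"
  proof (rule linorder_injI)
    fix i j :: nat assume "i < j"
    then have "x i \<epsilon> X j" by (simp add: mem_X)
    then show "x i \<noteq> x j" using x(2)[of j] by metis
  qed
  \<comment> \<open>Closure quantifies steps universally, so it imposes nothing at \<open>c\<close>,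
    where no step exists.\<close>
  define ev where "ev Y \<longleftrightarrow> (\<forall>K. (\<forall>z. is_empty mem z \<longrightarrow> z \<epsilon> K) \<and>
    (\<forall>z. z \<epsilon> K \<longrightarrow> (\<forall>u. step z u \<longrightarrow> (\<forall>w. step u w \<longrightarrow> w \<epsilon> K))) \<longrightarrow> Y \<epsilon> K)" for Y
  have ev_X: "ev (X (2 * n))" for n
    unfolding ev_def
  proof (intro allI impI, elim conjE)
    fix K assume empty: "\<forall>z. is_empty mem z \<longrightarrow> z \<epsilon> K"
      and closed: "\<forall>z. z \<epsilon> K \<longrightarrow> (\<forall>u. step z u \<longrightarrow> (\<forall>w. step u w \<longrightarrow> w \<epsilon> K))"
    show "X (2 * n) \<epsilon> K"
    proof (induction n)
      case 0
      then show ?case using empty X_0 by (simp add: is_empty_iff)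
    next
      case (Suc n)
      have "step (X (2 * n)) (X (Suc (2 * n)))" "step (X (Suc (2 * n))) (X (Suc (Suc (2 * n))))"
        by (simp_all add: X_step)
      then have "X (Suc (Suc (2 * n))) \<epsilon> K" using closed Suc by blast
      then show ?case by simp
    qed
  qed
  have ev_cases: "(\<exists>m\<le>n. Y = X (2 * m)) \<or> elts (X (2 * n + 2)) \<subseteq> elts Y" if "ev Y" for n Y
  proof -
    \<comment> \<open>\<open>ev Y\<close> is tested on the family \<open>K\<close> of the even
      stages up to \<open>2 * n\<close> and all subsets of \<open>c\<close> containing
      \<open>X (2 * n + 2)\<close>. Two steps lead to the next even stage or enlarge a set of the
      second kind.\<close>
    obtain p where p: "\<And>x. x \<epsilon> p \<longleftrightarrow> incl mem x c"
      using power_sets unfolding power_sets_def by blast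
    have "{w. w \<epsilon> p \<and> sat mem (((\<lambda>_. X (2 * n + 2)))(0 := w)) (Forall 2 (Imp (Rel 2 1) (Rel 2 0)))} \<in> range elts"
      by (rule separation_range[OF separation])
    then have "{w. incl mem w c \<and> elts (X (2 * n + 2)) \<subseteq> elts w} \<in> range elts"
      by (simp add: p subset_iff)
    then have "(\<lambda>m. X (2 * m)) ` {..n} \<union> {w. incl mem w c \<and> elts (X (2 * n + 2)) \<subseteq> elts w} \<in> range elts"
      by (rule range_Un[OF range_finite, rotated]) simp
    then obtain K where K: "elts K = (\<lambda>m. X (2 * m)) ` {..n} \<union>
      {w. incl mem w c \<and> elts (X (2 * n + 2)) \<subseteq> elts w}"
      by (elim imageE) simp
    have K_iff: "w \<epsilon> K \<longleftrightarrow> (\<exists>m\<le>n. w = X (2 * m)) \<or> (elts w \<subseteq> elts c \<and> elts (X (2 * n + 2)) \<subseteq> elts w)" for w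
      using K mem_elts_iff[of w K] by (simp add: image_iff Bex_def incl_iff)
    have "z \<epsilon> K" if "is_empty mem z" for z
    proof -
      have "elts z = elts (X 0)" using that X_0 by (simp add: is_empty_iff)
      then have "z = X (2 * 0)" by simp
      then show ?thesis unfolding K_iff by blast
    qed
    moreover have "w \<epsilon> K" if z: "z \<epsilon> K" "step z u" "step u w" for z u w
      using z(1) unfolding K_iff[of z]
    proof
      assume "\<exists>m\<le>n. z = X (2 * m)"
      then obtain m where m: "m \<le> n" "z = X (2 * m)" by blast
      then have "u = X (Suc (2 * m))" using z(2) X_step by blast
      then have w: "w = X (2 * m + 2)" using z(3) X_step by simp
      show ?thesis
      proof (cases "m = n")
        case True
        then show ?thesis unfolding K_iff using X_finite w by blast
      next
        case False
        then have "Suc m \<le> n" "w = X (2 * Suc m)" using m w by simp_all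
        then show ?thesis unfolding K_iff by blast
      qed
    next
      assume "elts z \<subseteq> elts c \<and> elts (X (2 * n + 2)) \<subseteq> elts z"
      moreover obtain s t where "s \<epsilon> c" "elts u = insert s (elts z)" "t \<epsilon> c" "elts w = insert t (elts u)"
        using step_point[OF z(2)] step_point[OF z(3)] by blast
      ultimately show ?thesis unfolding K_iff by auto
    qed
    ultimately have "Y \<epsilon> K" using \<open>ev Y\<close> unfolding ev_def by blast
    then show ?thesis unfolding K_iff by blast
  qed
  define b where "b = {y. y \<epsilon> c \<and> (\<exists>Y Z. ev Y \<and> step Y Z \<and> y \<epsilon> Z \<and> \<not> y \<epsilon> Y)}"
  have "x (2 * n) \<in> b" for n
    unfolding b_def using ev_X[of n] X_step[of "2 * n"] mem_X x(1)
    by (intro CollectI conjI exI[of _ "X (2 * n)"] exI[of _ "X (Suc (2 * n))"]) simp_all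
  then have "range (\<lambda>n. x (2 * n)) \<subseteq> b" by blast
  moreover have "inj (\<lambda>n. x (2 * n))" by (rule injI, drule injD[OF inj_x]) simp
  ultimately have "infinite b" using finite_subset finite_imageD infinite_UNIV_nat by metis
  \<comment> \<open>\<open>X (2 * n + 2)\<close> is the first even stage that contains this point:
    earlier even stages do not add it in one step, and supersets already have it.\<close>
  have "x (2 * n + 1) \<notin> b" for n
  proof
    assume "x (2 * n + 1) \<in> b"
    then obtain Y Z where Y: "ev Y" "step Y Z" "x (2 * n + 1) \<epsilon> Z" "\<not> x (2 * n + 1) \<epsilon> Y"
      unfolding b_def by blast
    from ev_cases[OF Y(1), of n] show False
    proof
      assume "\<exists>m\<le>n. Y = X (2 * m)"
      then obtain m where "m \<le> n" "Y = X (2 * m)" by blast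
      then show False using Y(2,3) X_step mem_X by simp
    next
      assume "elts (X (2 * n + 2)) \<subseteq> elts Y"
      moreover have "x (2 * n + 1) \<in> elts (X (2 * n + 2))" by (simp add: mem_X)
      ultimately show False using Y(4) by auto
    qed
  qed
  then have "range (\<lambda>n. x (2 * n + 1)) \<subseteq> elts c - b" using x(1) by auto
  moreover have "inj (\<lambda>n. x (2 * n + 1))" by (rule injI, drule injD[OF inj_x]) simp
  ultimately have "infinite (elts c - b)" using finite_subset finite_imageD infinite_UNIV_nat by metis
  define step_fm where
    "step_fm = (\<lambda>Y Z. Ex 7 (Conj (Rel 7 2) (Conj (fm_upair 7 Y Z) (fm_point_extension 1 Y Z))))"
  define ev_fm where "ev_fm = Forall 8 (Imp (Conj
    (Forall 9 (Imp (Neg (Ex 10 (Rel 10 9))) (Rel 9 8)))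
    (Forall 9 (Imp (Rel 9 8) (Forall 10 (Imp (step_fm 9 10) (Forall 11 (Imp (step_fm 10 11) (Rel 11 8))))))))
    (Rel 3 8))"
  define \<phi> where "\<phi> = Ex 3 (Ex 4 (Conj ev_fm (Conj (step_fm 3 4) (Conj (Rel 0 4) (Neg (Rel 0 3))))))"
  have sat_step: "sat mem v (step_fm Y Z) \<longleftrightarrow> step (v Y) (v Z)"
    if "v 1 = c" "v 2 = C" "Y < 20" "Z < 20" "Y \<noteq> 7" "Z \<noteq> 7" for v Y Z
    using that unfolding step_fm_def step_def by (simp add: sat_fm_upair sat_fm_point_extension)
  have sat_ev: "sat mem v ev_fm \<longleftrightarrow> ev (v 3)" if "v 1 = c" "v 2 = C" for v
    using that unfolding ev_fm_def ev_def is_empty_def by (simp add: sat_step) blast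
  \<comment> \<open>Variable 1 denotes \<open>c\<close> by default and 2 denotes the selector
    \<open>C\<close>.\<close>
  have "{y. y \<epsilon> c \<and> sat mem (((\<lambda>_. c)(2 := C))(0 := y)) \<phi>} \<in> range elts"
    by (rule separation_range[OF separation])
  then have "b \<in> range elts" unfolding b_def \<phi>_def by (simp add: sat_step sat_ev)
  moreover have "b \<subseteq> elts c" unfolding b_def by auto
  ultimately show ?thesis
    unfolding splits_def using \<open>infinite b\<close> \<open>infinite (elts c - b)\<close> by (intro bexI[of _ b]) simp_all
qed

end

section \<open>Common consequences of the ZF and KP axioms\<close>

lemma basic_set_theory_ZF:
  assumes "ZF_without_infinity mem"
  shows "basic_set_theory mem"
  using assms unfolding ZF_without_infinity_def by unfold_locales auto

lemma basic_set_theory_KP: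
  assumes "model_KP mem"
  shows "basic_set_theory mem"
proof -
  have "regularity mem"
    unfolding regularity_def
  proof (intro allI impI)
    fix a assume "\<not> is_empty mem a"
    then have "\<exists>x. sat mem ((\<lambda>_. a)(0 := x)) (Rel 0 1)" by (simp add: is_empty_def)
    moreover have "foundation_for mem (Rel 0 1)" using assms unfolding model_KP_def by blast
    ultimately have "\<exists>x. sat mem ((\<lambda>_. a)(0 := x)) (Rel 0 1) \<and>
      (\<forall>y. mem y x \<longrightarrow> \<not> sat mem ((\<lambda>_. a)(0 := y)) (Rel 0 1))"
      unfolding foundation_for_def by blast
    then show "\<exists>x. mem x a \<and> \<not> (\<exists>y. mem y x \<and> mem y a)" by auto
  qed
  then show ?thesis using assms unfolding model_KP_def by unfold_locales auto
qed

text \<open>Only a superset of the pairs is demanded, so that collection yields it directly in KP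
  and replacement in ZF.\<close>

definition upair_family :: "('m \<Rightarrow> 'm \<Rightarrow> bool) \<Rightarrow> bool" where
  "upair_family mem \<longleftrightarrow> (\<forall>w u. \<exists>b. \<forall>x. mem x w \<longrightarrow> (\<exists>y. mem y b \<and> is_upair mem y x u))"

lemma upair_family_ZF:
  assumes "ZF_without_infinity mem"
  shows "upair_family mem"
  unfolding upair_family_def
proof (intro allI)
  fix w u
  interpret basic_set_theory mem using assms by (rule basic_set_theory_ZF)
  have sat: "sat mem ((\<lambda>_. u)(0 := x, 1 := y)) (fm_upair 1 0 2) \<longleftrightarrow> is_upair mem y x u" for x y
    by (simp add: sat_fm_upair)
  have ex1: "\<exists>!y. is_upair mem y x u" for x
    using finite_set_exists[of "{x, u}"] elts_inject unfolding is_upair_iff by (metis finite.emptyI finite_insert)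
  have "replacement_for mem (fm_upair 1 0 2)"
    using assms unfolding ZF_without_infinity_def by blast
  from this[unfolded replacement_for_def, THEN spec[of _ "\<lambda>_. u"], THEN spec[of _ w]]
  have "\<exists>b. \<forall>y. mem y b \<longleftrightarrow> (\<exists>x. mem x w \<and> is_upair mem y x u)"
    unfolding sat using ex1 by blast
  then show "\<exists>b. \<forall>x. mem x w \<longrightarrow> (\<exists>y. mem y b \<and> is_upair mem y x u)"
    using ex1 by blast
qed

lemma upair_family_KP:
  assumes "model_KP mem"
  shows "upair_family mem"
  unfolding upair_family_def
proof (intro allI)
  fix w u
  have sat: "sat mem ((\<lambda>_. u)(0 := x, 1 := y)) (fm_upair 1 0 2) \<longleftrightarrow> is_upair mem y x u" for x y
    by (simp add: sat_fm_upair)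
  have ex: "\<exists>y. is_upair mem y x u" for x
    using assms unfolding model_KP_def pairing_def by blast
  have "collection_for mem (fm_upair 1 0 2)"
    using assms delta0_fm_upair[of 1] unfolding model_KP_def by simp
  from this[unfolded collection_for_def, THEN spec[of _ "\<lambda>_. u"], THEN spec[of _ w]]
  show "\<exists>b. \<forall>x. mem x w \<longrightarrow> (\<exists>y. mem y b \<and> is_upair mem y x u)"
    unfolding sat using ex by blast
qed

lemma local_foundation_ZF:
  assumes "ZF_without_infinity mem"
  shows "local_foundation mem"
  unfolding local_foundation_def
proof (intro allI impI)
  fix \<phi> v a
  assume local: "\<forall>x. sat mem (v(0 := x)) \<phi> \<longrightarrow> mem x a" and ex: "\<exists>x. sat mem (v(0 := x)) \<phi>"
  have "separation_for mem \<phi>" using assms unfolding ZF_without_infinity_def by blast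
  then obtain b where b: "\<And>x. mem x b \<longleftrightarrow> mem x a \<and> sat mem (v(0 := x)) \<phi>"
    unfolding separation_for_def by metis
  then have "\<not> is_empty mem b" using local ex unfolding is_empty_def by blast
  then obtain x where "mem x b" "\<not> (\<exists>y. mem y x \<and> mem y b)"
    using assms unfolding ZF_without_infinity_def regularity_def by blast
  then show "\<exists>x. sat mem (v(0 := x)) \<phi> \<and> (\<forall>y. mem y x \<longrightarrow> \<not> sat mem (v(0 := y)) \<phi>)"
    using b local by blast
qed

lemma local_foundation_KP: "model_KP mem \<Longrightarrow> local_foundation mem"
  unfolding model_KP_def local_foundation_def foundation_for_def by blast

theorem theorem5:
  fixes mem :: "'m \<Rightarrow> 'm \<Rightarrow> bool"
  assumes "model_ZFC mem
    \<or> (model_KP mem \<and> \<not> (\<exists>a. amorphous mem a))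
    \<or> (model_KP mem \<and> omega_nonstandard mem)
    \<or> (model_ZF_neg_infinity mem \<and> omega_nonstandard mem)"
  shows "set_theoretic_mereology (incl mem) \<and> omega_saturated (incl mem)"
proof -
  have ZF_or_KP: "ZF_without_infinity mem \<or> model_KP mem"
    using assms unfolding model_ZFC_def model_ZF_neg_infinity_def by blast
  interpret basic_set_theory mem
    using ZF_or_KP basic_set_theory_ZF basic_set_theory_KP by blast
  have "upair_family mem" using ZF_or_KP upair_family_ZF upair_family_KP by blast
  have "local_foundation mem" using ZF_or_KP local_foundation_ZF local_foundation_KP by blast
  \<comment> \<open>Without infinity, the externally infinite set is a nonstandard natural.\<close>
  have "infinity mem \<or> omega_nonstandard mem"
    using assms unfolding model_ZFC_def model_KP_def by blast
  then obtain w where w: "infinite (elts w)"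
    using infinity_infinite_set omega_nonstandard_infinite_natural by blast
  have "splits c" if c: "infinite (elts c)" for c
  \<comment> \<open>The split is not along the four kinds: models of the first two may be
    nonstandard too, and overspill then handles them. Without an infinite natural, only these two
    kinds remain.\<close>
  proof (cases "\<exists>n. is_natural mem n \<and> infinite (elts n)")
    case True
    then obtain n where n: "is_natural mem n" "infinite (elts n)" by blast
    show ?thesis
      by (rule splits_if_infinite_natural[OF \<open>local_foundation mem\<close> n c])
  next
    case False
    then have "model_ZFC mem \<or> \<not> (\<exists>a. amorphous mem a)"
      using assms omega_nonstandard_infinite_natural by blast
    then show ?thesis
    proof
      assume "model_ZFC mem"
      then show ?thesis
        unfolding model_ZFC_def ZF_without_infinity_def by (blast intro: splits_if_choice[OF _ _ _ c])
    next
      assume "\<not> (\<exists>a. amorphous mem a)"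
      then show ?thesis using splits_if_not_amorphous[OF _ _ c] False by blast
    qed
  qed
  then show ?thesis
    using mereology_and_saturation[OF _ w] \<open>upair_family mem\<close>
    unfolding upair_family_def splits_def by blast
qed

end
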